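(* Let $I$ be a measurable subset of $[-1,1]$. Then the following are equivalent. (i) $I$ is a Gabor-Heisenberg (GH) frame set. (ii) $I$ is translation congruent with a subset of the unit interval $[0,1]$.
   Context: All sets and functions are Lebesgue measurable, and sets whose symmetric difference has Lebesgue measure zero are identified. $L^2(I\times\mathbb{R})$ is taken with respect to the measure $|\lambda|\,d\lambda\,dt$. A system $\{\psi_j\}_{j\in J}$ in a separable Hilbert space $\mathcal{H}$ is a Parseval frame for $\mathcal{H}$ if $\|f\|^2=\sum_{j\in J}|\langle f,\psi_j\rangle|^2$ for all $f\in\mathcal{H}$. For $k,l,m\in\mathbb{Z}$: $\hat T_{k,l,m}g(\lambda,t)=e^{2\pi i\lambda m}e^{-2\pi i\lambda l t}g(\lambda,t-k)$. $g\in L^2(I\times\mathbb{R})$ is a Gabor field over $I$ with lattice parameters $\alpha=\beta=1$ if for a.e. $\lambda\in I$ the system $\{t\mapsto|\lambda|^{1/2}e^{-2\pi i\lambda l t}g(\lambda,t-k): k,l\in\mathbb{Z}\}$ is a Parseval frame for $L^2(\mathbb{R})$. A subset $I$ of $[-1,1]$ is a Gabor-Heisenberg (GH) frame set if for every $g\in L^2(I\times\mathbb{R})$ that is a Gabor field over $I$ with lattice parameters $\alpha=\beta=1$, the system $\{\hat T_{k,l,m}g: k,l,m\in\mathbb{Z}\}$ is a Parseval frame for $L^2(I\times\mathbb{R})$. Subsets $I,J$ of $\mathbb{R}$ are translation congruent if there is a bijection $\tau:I\to J$ and an integer-valued (measurable) function $k$ on $I$ with $\tau(\lambda)=\lambda+k(\lambda)$.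 (Modulo null sets, $I$ is translation congruent with a subset of $[0,1]$ iff the integer translates of $I$ are disjoint.) *)

theory Defs
  imports "HOL-Analysis.Analysis"
begin

text \<open>
  The Hilbert space \<open>L\<^sup>2(M)\<close> is handled through representatives: its elements are the complex
  functions satisfying \<open>square_integrable M\<close>, taken up to equality almost everywhere.
\<close>

definition square_integrable :: "'a measure \<Rightarrow> ('a \<Rightarrow> complex) \<Rightarrow> bool" where
  "square_integrable M f \<longleftrightarrow>
     f \<in> borel_measurable M \<and> integrable M (\<lambda>x. (cmod (f x))\<^sup>2)"

definition L2_inner :: "'a measure \<Rightarrow> ('a \<Rightarrow> complex) \<Rightarrow> ('a \<Rightarrow> complex) \<Rightarrow> complex" where
  "L2_inner M f g = (\<integral>x. f x * cnj (g x) \<partial>M)"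

definition L2_norm :: "'a measure \<Rightarrow> ('a \<Rightarrow> complex) \<Rightarrow> real" where
  "L2_norm M f = sqrt (\<integral>x. (cmod (f x))\<^sup>2 \<partial>M)"

definition parseval_frame_L2 ::
  "'a measure \<Rightarrow> 'j set \<Rightarrow> ('j \<Rightarrow> 'a \<Rightarrow> complex) \<Rightarrow> bool" where
  "parseval_frame_L2 M J \<psi> \<longleftrightarrow>
     (\<forall>j\<in>J. square_integrable M (\<psi> j)) \<and>
     (\<forall>f. square_integrable M f \<longrightarrow>
        ((\<lambda>j. (cmod (L2_inner M f (\<psi> j)))\<^sup>2) has_sum (L2_norm M f)\<^sup>2) J)"

text \<open>The set \<open>I \<times> \<real>\<close> with the measure \<open>|\<xi>| d\<xi> dt\<close> on its Lebesgue measurable subsets;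
  the frequency variable is written \<open>\<xi>\<close> since the usual letter is reserved for abstraction.\<close>

definition field_measure :: "real set \<Rightarrow> (real \<times> real) measure" where
  "field_measure I = density (lebesgue_on (I \<times> UNIV)) (\<lambda>(\<xi>, t). ennreal \<bar>\<xi>\<bar>)"

definition T_hat ::
  "int \<Rightarrow> int \<Rightarrow> int \<Rightarrow> (real \<times> real \<Rightarrow> complex) \<Rightarrow> real \<times> real \<Rightarrow> complex" where
  "T_hat k l m g = (\<lambda>(\<xi>, t).
     cis (2 * pi * \<xi> * of_int m) * cis (- (2 * pi * \<xi> * of_int l * t)) * g (\<xi>, t - of_int k))"

definition gabor_field :: "real set \<Rightarrow> (real \<times> real \<Rightarrow> complex) \<Rightarrow> bool" where
  "gabor_field I g \<longleftrightarrow>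
     square_integrable (field_measure I) g \<and>
     (AE \<xi> in lebesgue_on I.
        parseval_frame_L2 lebesgue UNIV
          (\<lambda>(k :: int, l :: int) t.
             complex_of_real (sqrt \<bar>\<xi>\<bar>) * cis (- (2 * pi * \<xi> * of_int l * t)) *
             g (\<xi>, t - of_int k)))"

definition GH_frame_set :: "real set \<Rightarrow> bool" where
  "GH_frame_set I \<longleftrightarrow>
     I \<in> sets lebesgue \<and> I \<subseteq> {-1..1} \<and>
     (\<forall>g. gabor_field I g \<longrightarrow>
        parseval_frame_L2 (field_measure I) UNIV (\<lambda>(k, l, m). T_hat k l m g))"

definition translation_congruent_strict :: "real set \<Rightarrow> real set \<Rightarrow> bool" where
  "translation_congruent_strict I J \<longleftrightarrow>
     (\<exists>\<tau> (k :: real \<Rightarrow> int).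
        bij_betw \<tau> I J \<and> k \<in> measurable (lebesgue_on I) (count_space UNIV) \<and>
        (\<forall>x\<in>I. \<tau> x = x + of_int (k x)))"

text \<open>
  Sets that differ by a Lebesgue null set are identified, so translation congruence is a relation
  between classes of sets: it asks for a bijection between suitable representatives.
\<close>

definition equal_mod_null :: "real set \<Rightarrow> real set \<Rightarrow> bool" where
  "equal_mod_null A B \<longleftrightarrow> sym_diff A B \<in> null_sets lebesgue"

definition translation_congruent :: "real set \<Rightarrow> real set \<Rightarrow> bool" where
  "translation_congruent I J \<longleftrightarrow>
     (\<exists>I' J'. I' \<in> sets lebesgue \<and> J' \<in> sets lebesgue \<and>
        equal_mod_null I I' \<and> equal_mod_null J J' \<and> translation_congruent_strict I' J')"

end

theory Submission
  imports Defs
begin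

text \<open>
  Because \<open>I\<close> lies in \<open>[-1,1]\<close>, the only integer translate that can meet it in positive measure is
  the one by \<open>1\<close> (up to sign), and being translation congruent to a subset of \<open>[0,1]\<close> means that
  \<open>{x \<in> I. x + 1 \<in> I}\<close> is null (\<open>congruent_imp_disjoint_translates\<close>,
  \<open>disjoint_translates_imp_congruent\<close>). This null condition is compared with the frame property.

  Multiplication by \<open>|\<xi>|\<^sup>1\<^sup>/\<^sup>2\<close> removes the weight of the measure. Fubini's theorem then shows that
  the inner product of \<open>f\<close> with \<open>T_hat k l m g\<close> is the \<open>m\<close>-th Fourier coefficient of the function
  \<open>F\<^sub>k\<^sub>l\<close> on \<open>I\<close> whose value at \<open>\<xi>\<close> is the inner product of the fibre of \<open>f\<close> over \<open>\<xi>\<close> with the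
  \<open>(k,l)\<close>-th element of the Gabor system over \<open>\<xi>\<close> (\<open>L2_inner_T_hat\<close>).

  If almost no two points of \<open>I\<close> differ by \<open>1\<close>, then folding \<open>I\<close> onto \<open>[0,1]\<close> loses nothing, and
  Parseval's identity for Fourier series yields \<open>\<Sum>\<^sub>m |\<langle>f, T_hat k l m g\<rangle>|\<^sup>2 = \<integral>\<^sub>I |F\<^sub>k\<^sub>l|\<^sup>2\<close>
  (\<open>fourier_parseval_disjoint_translates\<close>). Summing over \<open>k\<close> and \<open>l\<close> inside the integral, the Parseval
  frame property of each fibre (\<open>fiber_parseval\<close>) gives \<open>\<parallel>f\<parallel>\<^sup>2\<close>. The identity for Fourier series is
  proved from the density of trigonometric polynomials in \<open>L\<^sup>2[0,1]\<close>, which comes from the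
  Stone-Weierstrass theorem on the unit circle.

  Conversely, let \<open>C\<close> be a measurable set of points \<open>\<xi>\<close> with \<open>\<xi>\<close> and \<open>\<xi> + 1\<close> both in \<open>I\<close>. Take for \<open>g\<close> the field
  whose fibre is the indicator function of a unit interval starting at \<open>0\<close> and pointing in the
  direction of the sign of \<open>\<xi>\<close>. After the substitution \<open>x = \<xi> t\<close> the fibre window becomes
  \<open>[0, |\<xi>|)\<close>, so that the windows over \<open>\<xi>\<close> and over \<open>\<xi> + 1\<close> share the interval
  \<open>[0, min |\<xi>| |\<xi> + 1|)\<close>. Let \<open>f\<close> be the indicator function of this common part, with sign \<open>-1\<close> over \<open>C\<close>
  and \<open>+1\<close> over \<open>C + 1\<close>. The functions \<open>F\<^sub>k\<^sub>l\<close> of this \<open>f\<close> satisfy \<open>F\<^sub>k\<^sub>l(\<xi> + 1) = - F\<^sub>k\<^sub>l(\<xi>)\<close> on \<open>C\<close>, hence \<open>f\<close> is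
  orthogonal to every \<open>T_hat k l m g\<close>. If \<open>g\<close> generates a Parseval frame then \<open>f = 0\<close>, which forces
  \<open>C\<close> to be null (\<open>GH_frame_set_imp_disjoint_translates\<close>). The dependence of the window on the sign
  of \<open>\<xi>\<close> is essential: with the window \<open>[0,1)\<close> over every \<open>\<xi>\<close> the substitution yields intervals over \<open>\<xi>\<close> and
  \<open>\<xi> + 1\<close> that are disjoint modulo \<open>1\<close> up to a null set.
\<close>

section \<open>Characters and trigonometric polynomials\<close>

definition fourier_char :: "int \<Rightarrow> real \<Rightarrow> complex" where
  "fourier_char m x = cis (2 * pi * x * of_int m)"

lemma norm_fourier_char [simp]: "cmod (fourier_char m x) = 1"
  by (simp add: fourier_char_def)

lemma fourier_char_0 [simp]: "fourier_char 0 x = 1"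
  by (simp add: fourier_char_def)

lemma fourier_char_mult: "fourier_char m x * fourier_char n x = fourier_char (m + n) x"
  by (simp add: fourier_char_def cis_mult ring_distribs)

lemma fourier_char_add_arg: "fourier_char m (x + y) = fourier_char m x * fourier_char m y"
  by (simp add: fourier_char_def cis_mult ring_distribs)

lemma cnj_fourier_char: "cnj (fourier_char m x) = fourier_char (- m) x"
  by (simp add: fourier_char_def cis_cnj)

lemma fourier_char_of_int [simp]: "fourier_char m (of_int n) = 1"
proof -
  have "2 * pi * of_int n * of_int m = 2 * pi * (of_int (n * m) :: real)" by simp
  thus ?thesis unfolding fourier_char_def by (metis Ints_of_int cis_multiple_2pi)
qed

lemma fourier_char_borel [measurable]: "fourier_char m \<in> borel_measurable borel"
proof -
  have "continuous_on UNIV (fourier_char m)"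
    unfolding fourier_char_def[abs_def] by (intro continuous_intros)
  thus ?thesis by (rule borel_measurable_continuous_onI)
qed

lemma continuous_fourier_char: "continuous_on S (fourier_char m)"
  unfolding fourier_char_def[abs_def] by (intro continuous_intros)

lemma integral_fourier_char:
  "integral\<^sup>L (lebesgue_on {0..1}) (fourier_char m) = (if m = 0 then 1 else 0)"
proof (cases "m = 0")
  case True
  have "integral\<^sup>L (lebesgue_on {0..1::real}) (\<lambda>x. 1::complex) = 1"
    by (simp add: measure_restrict_space)
  with True show ?thesis by (simp add: fourier_char_def[abs_def])
next
  case False
  define G where "G x = fourier_char m x / (2 * pi * \<i> * of_int m)" for x
  have "(G has_vector_derivative fourier_char m x) (at x within {0..1})" for x
  proof -
    let ?E = "\<lambda>z. exp (2 * pi * \<i> * of_int m * z) / (2 * pi * \<i> * of_int m)"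
    have "(?E has_field_derivative exp (2 * pi * \<i> * of_int m * of_real x)) (at (of_real x))"
      using False by (auto intro!: derivative_eq_intros)
    from has_vector_derivative_real_field[OF this]
    show ?thesis by (simp add: G_def[abs_def] fourier_char_def cis_conv_exp mult_ac)
  qed
  hence "(fourier_char m has_integral (G 1 - G 0)) {0..1}"
    by (intro fundamental_theorem_of_calculus) auto
  moreover have "G 1 = G 0"
    using fourier_char_of_int[of m 1] fourier_char_of_int[of m 0] by (simp add: G_def)
  ultimately have "integral {0..1} (fourier_char m) = 0" by (simp add: integral_unique)
  moreover have "integrable (lebesgue_on {0..1}) (fourier_char m)"
    by (intro continuous_imp_integrable_real continuous_fourier_char)
  ultimately show ?thesis using False by (simp add: lebesgue_integral_eq_integral)
qed

lemma orthonormal_fourier_char: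
  "integral\<^sup>L (lebesgue_on {0..1}) (\<lambda>x. fourier_char m x * cnj (fourier_char n x)) = (if m = n then 1 else 0)"
proof -
  have "(\<lambda>x. fourier_char m x * cnj (fourier_char n x)) = fourier_char (m - n)"
    by (auto simp: cnj_fourier_char fourier_char_mult fun_eq_iff)
  thus ?thesis using integral_fourier_char[of "m - n"] by auto
qed

text \<open>Closure under products is then proved by induction on both factors, and the coefficients are
  recovered by \<open>trig_poly_eq_sum\<close>.\<close>

inductive trig_poly :: "(real \<Rightarrow> complex) \<Rightarrow> bool" where
  monomial: "trig_poly (\<lambda>x. c * fourier_char m x)"
| add: "trig_poly P \<Longrightarrow> trig_poly Q \<Longrightarrow> trig_poly (\<lambda>x. P x + Q x)"

lemma trig_poly_const: "trig_poly (\<lambda>x. c)"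
  using trig_poly.monomial[of c 0] by simp

lemma trig_poly_mult:
  assumes "trig_poly P" "trig_poly Q"
  shows "trig_poly (\<lambda>x. P x * Q x)"
  using assms(1)
proof induction
  case (monomial c m)
  show ?case using assms(2)
  proof induction
    case (monomial d n)
    have "(\<lambda>x. c * fourier_char m x * (d * fourier_char n x)) = (\<lambda>x. c * d * fourier_char (m + n) x)"
      by (simp add: fun_eq_iff fourier_char_mult[symmetric])
    thus ?case by (simp add: trig_poly.monomial)
  next
    case (add P Q)
    thus ?case using trig_poly.add[OF add.IH] by (simp add: ring_distribs)
  qed
next
  case (add P Q)
  thus ?case using trig_poly.add[OF add.IH] by (simp add: ring_distribs)
qed

lemma trig_poly_eq_sum:
  assumes "trig_poly P"
  shows "\<exists>K c. finite K \<and> P = (\<lambda>x. \<Sum>m\<in>K. c m * fourier_char m x)"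
  using assms
proof induction
  case (monomial c m)
  show ?case by (rule exI[of _ "{m}"], rule exI[of _ "\<lambda>_. c"]) auto
next
  case (add P Q)
  obtain K c where K: "finite K" "P = (\<lambda>x. \<Sum>m\<in>K. c m * fourier_char m x)"
    using add.IH(1) by blast
  obtain L d where L: "finite L" "Q = (\<lambda>x. \<Sum>m\<in>L. d m * fourier_char m x)"
    using add.IH(2) by blast
  have "P x = (\<Sum>m\<in>K \<union> L. (if m \<in> K then c m else 0) * fourier_char m x)" for x
    unfolding K using K(1) L(1) by (intro sum.mono_neutral_cong_left) auto
  moreover have "Q x = (\<Sum>m\<in>K \<union> L. (if m \<in> L then d m else 0) * fourier_char m x)" for x
    unfolding L using K(1) L(1) by (intro sum.mono_neutral_cong_left) auto
  ultimately have eq: "(\<lambda>x. P x + Q x) = (\<lambda>x. \<Sum>m\<in>K \<union> L.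
      ((if m \<in> K then c m else 0) + (if m \<in> L then d m else 0)) * fourier_char m x)"
    by (simp add: fun_eq_iff ring_distribs sum.distrib)
  show ?case
    by (rule exI[of _ "K \<union> L"], rule exI[of _ "\<lambda>m. (if m \<in> K then c m else 0) + (if m \<in> L then d m else 0)"])
       (use eq K(1) L(1) in simp)
qed

text \<open>On the unit circle both real coordinates are combinations of the characters \<open>1\<close> and \<open>-1\<close>, and
  trigonometric polynomials form an algebra.\<close>

lemma trig_poly_real_polynomial_function:
  fixes q :: "complex \<Rightarrow> real"
  assumes "real_polynomial_function q"
  shows "trig_poly (\<lambda>x. of_real (q (cis (2 * pi * x))))"
  using assms
proof induction
  case (linear f)
  \<comment> \<open>Real linear functionals are determined by their values at \<open>1\<close> and \<open>\<i>\<close>; on the circle \<open>Re\<close> and \<open>Im\<close> are the cosine and the sine.\<close>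
  have f: "f z = Re z * f 1 + Im z * f \<i>" for z
  proof -
    have "f z = f (Re z *\<^sub>R 1 + Im z *\<^sub>R \<i>)"
      by (rule arg_cong[of _ _ f]) (simp add: complex_eq_iff)
    also have "\<dots> = Re z * f 1 + Im z * f \<i>"
      by (simp only: linear_add[OF bounded_linear.linear[OF linear]]
          linear_scale[OF bounded_linear.linear[OF linear]] real_scaleR_def)
    finally show ?thesis .
  qed
  have *: "complex_of_real (f (cis (2 * pi * x))) =
     (of_real (f 1) / 2 - \<i> * of_real (f \<i>) / 2) * fourier_char 1 x
     + (of_real (f 1) / 2 + \<i> * of_real (f \<i>) / 2) * fourier_char (-1) x" for x
    unfolding f[of "cis (2 * pi * x)"] by (rule complex_eqI; simp add: fourier_char_def)
  show ?case
    by (subst *) (rule trig_poly.add[OF trig_poly.monomial trig_poly.monomial])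
next
  case (const c)
  show ?case by (rule trig_poly_const)
next
  case (add f g)
  thus ?case using trig_poly.add[OF add.IH] by simp
next
  case (mult f g)
  thus ?case using trig_poly_mult[OF mult.IH] by simp
qed

text \<open>The Stone-Weierstrass theorem on the circle supplies a polynomial in the real coordinates.\<close>

lemma trig_poly_dense_circle:
  fixes h :: "complex \<Rightarrow> complex"
  assumes h: "continuous_on (sphere 0 1) h" and e: "e > 0"
  obtains P where "trig_poly P" "\<And>x. cmod (h (cis (2 * pi * x)) - P x) < e"
proof -
  obtain g where g: "polynomial_function g" "\<And>z. z \<in> sphere 0 1 \<Longrightarrow> norm (h z - g z) < e"
    using Stone_Weierstrass_polynomial_function[OF compact_sphere h e] by blast
  have "real_polynomial_function (Re \<circ> g)" "real_polynomial_function (Im \<circ> g)"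
    using g(1) bounded_linear_Re bounded_linear_Im unfolding polynomial_function_def by auto
  from this[THEN trig_poly_real_polynomial_function]
  have "trig_poly (\<lambda>x. of_real (Re (g (cis (2 * pi * x)))) + \<i> * of_real (Im (g (cis (2 * pi * x)))))"
    by (intro trig_poly.add trig_poly_mult trig_poly_const) (auto simp: o_def)
  hence "trig_poly (\<lambda>x. g (cis (2 * pi * x)))" by (simp flip: complex_eq)
  with g(2) show ?thesis by (intro that) auto
qed

section \<open>Square integrable functions\<close>

lemma norm_diff_square_le:
  fixes a b c :: complex
  shows "(cmod (a - c))\<^sup>2 \<le> 2 * (cmod (a - b))\<^sup>2 + 2 * (cmod (b - c))\<^sup>2"
proof -
  have "(cmod (a - c))\<^sup>2 \<le> (cmod (a - b) + cmod (b - c))\<^sup>2"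
    by (intro power_mono) (use norm_triangle_ineq[of "a - b" "b - c"] in auto)
  also have "\<dots> \<le> 2 * (cmod (a - b))\<^sup>2 + 2 * (cmod (b - c))\<^sup>2"
    using sum_squares_bound[of "cmod (a - b)" "cmod (b - c)"] by (simp add: power2_sum)
  finally show ?thesis .
qed

lemma square_integrable_mult_integrable:
  assumes "square_integrable M f" "square_integrable M g"
  shows "integrable M (\<lambda>x. f x * g x)"
proof (rule Bochner_Integration.integrable_bound)
  show "integrable M (\<lambda>x. (cmod (f x))\<^sup>2 + (cmod (g x))\<^sup>2)"
    using assms by (auto simp: square_integrable_def)
  show "(\<lambda>x. f x * g x) \<in> borel_measurable M"
    using assms by (auto simp: square_integrable_def)
  have "a * b \<le> a\<^sup>2 + b\<^sup>2" if "a \<ge> 0" "b \<ge> 0" for a b :: real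
    using sum_squares_bound[of a b] mult_nonneg_nonneg[OF that] by linarith
  thus "AE x in M. cmod (f x * g x) \<le> norm ((cmod (f x))\<^sup>2 + (cmod (g x))\<^sup>2)"
    by (auto simp: norm_mult)
qed

lemma borel_measurable_cnj [measurable]: "cnj \<in> borel_measurable borel"
  by (intro borel_measurable_continuous_onI continuous_intros)

lemma square_integrable_cnj [simp]:
  "square_integrable M f \<Longrightarrow> square_integrable M (\<lambda>x. cnj (f x))"
  by (auto simp: square_integrable_def)

lemma square_integrable_diff:
  assumes "square_integrable M f" "square_integrable M g"
  shows "square_integrable M (\<lambda>x. f x - g x)"
proof -
  have [measurable]: "f \<in> borel_measurable M" "g \<in> borel_measurable M"
    using assms by (auto simp: square_integrable_def)
  have "integrable M (\<lambda>x. (cmod (f x - g x))\<^sup>2)"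
  proof (rule Bochner_Integration.integrable_bound)
    show "integrable M (\<lambda>x. 2 * (cmod (f x))\<^sup>2 + 2 * (cmod (g x))\<^sup>2)"
      using assms by (auto simp: square_integrable_def)
    show "AE x in M. norm ((cmod (f x - g x))\<^sup>2) \<le> norm (2 * (cmod (f x))\<^sup>2 + 2 * (cmod (g x))\<^sup>2)"
      using norm_diff_square_le[of _ _ 0] by (auto intro!: AE_I2)
  qed measurable
  thus ?thesis by (simp add: square_integrable_def)
qed

text \<open>This replaces the triangle inequality for the \<open>L\<^sup>2\<close> norm; since distances are only ever made
  arbitrarily small, the factor \<open>2\<close> does no harm, and square roots are avoided.\<close>

lemma integral_norm_diff_square_le:
  assumes "square_integrable M f" "square_integrable M g" "square_integrable M h"
  shows "(\<integral>x. (cmod (f x - h x))\<^sup>2 \<partial>M)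
    \<le> 2 * (\<integral>x. (cmod (f x - g x))\<^sup>2 \<partial>M) + 2 * (\<integral>x. (cmod (g x - h x))\<^sup>2 \<partial>M)"
proof -
  have i: "integrable M (\<lambda>x. (cmod (f x - h x))\<^sup>2)" "integrable M (\<lambda>x. (cmod (f x - g x))\<^sup>2)"
     "integrable M (\<lambda>x. (cmod (g x - h x))\<^sup>2)"
    using square_integrable_diff[OF assms(1,3)] square_integrable_diff[OF assms(1,2)]
      square_integrable_diff[OF assms(2,3)] by (auto simp: square_integrable_def)
  have "(\<integral>x. (cmod (f x - h x))\<^sup>2 \<partial>M) \<le> (\<integral>x. 2 * (cmod (f x - g x))\<^sup>2 + 2 * (cmod (g x - h x))\<^sup>2 \<partial>M)"
    using i by (intro integral_mono) (auto intro: norm_diff_square_le)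
  thus ?thesis using i by simp
qed

lemma square_integrable_bounded:
  assumes "finite_measure M" "f \<in> borel_measurable M" "\<And>x. x \<in> space M \<Longrightarrow> cmod (f x) \<le> B"
  shows "square_integrable M f"
proof -
  have "integrable M (\<lambda>x. (cmod (f x))\<^sup>2)"
    using assms by (intro finite_measure.integrable_const_bound[where B = "B\<^sup>2"])
      (auto intro!: AE_I2 power_mono)
  with assms show ?thesis by (simp add: square_integrable_def)
qed

text \<open>Lebesgue measure on the plane is the completion of the product of the Borel-Lebesgue measures on
  the lines and not itself a product; replacing functions by Borel measurable ones makes Fubini's theorem
  applicable.\<close>

lemma lebesgue_borel_version:
  fixes f :: "'a::euclidean_space \<Rightarrow> complex"
  assumes "f \<in> borel_measurable lebesgue"
  obtains f' where "f' \<in> borel_measurable borel" "AE x in lborel. f x = f' x"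
proof -
  have "(\<lambda>x. Re (f x)) \<in> borel_measurable lebesgue" "(\<lambda>x. Im (f x)) \<in> borel_measurable lebesgue"
    using assms by measurable
  then obtain u v where u: "u \<in> borel_measurable lborel" "AE x in lborel. Re (f x) = u x"
    and v: "v \<in> borel_measurable lborel" "AE x in lborel. Im (f x) = v x"
    by (metis completion_ex_borel_measurable_real)
  have "(\<lambda>x. Complex (u x) (v x)) \<in> borel_measurable borel"
    using u(1) v(1) unfolding Complex_eq by measurable
  moreover have "AE x in lborel. f x = Complex (u x) (v x)"
    using u(2) v(2) by eventually_elim (simp add: complex_eq_iff)
  ultimately show ?thesis by (rule that)
qed

lemma integrable_lebesgue_lborel_cong:
  fixes f g :: "'a::euclidean_space \<Rightarrow> 'b::{banach, second_countable_topology}"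
  assumes f: "f \<in> borel_measurable lebesgue" and g: "g \<in> borel_measurable borel"
    and eq: "AE x in lborel. f x = g x"
  shows "integrable lebesgue f \<longleftrightarrow> integrable lborel g"
    and "integral\<^sup>L lebesgue f = integral\<^sup>L lborel g"
proof -
  have g': "g \<in> borel_measurable lebesgue" using g by (intro measurable_completion) simp
  have ae: "AE x in lebesgue. f x = g x" using eq by (simp add: AE_completion)
  show "integrable lebesgue f \<longleftrightarrow> integrable lborel g"
    using integrable_cong_AE[OF f g' ae] g by (simp add: integrable_completion)
  show "integral\<^sup>L lebesgue f = integral\<^sup>L lborel g"
    using integral_cong_AE[OF f g' ae] g by (simp add: integral_completion)
qed

text \<open>Sums of nonnegative terms become integrals over a counting measure, so that iterated sums and
  integrals can be exchanged by Tonelli's theorem.\<close>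

lemma has_sum_iff_nn_integral:
  fixes f :: "'a \<Rightarrow> real"
  assumes f: "\<And>x. f x \<ge> 0" and s: "s \<ge> 0"
  shows "(f has_sum s) UNIV \<longleftrightarrow> (\<integral>\<^sup>+x. ennreal (f x) \<partial>count_space UNIV) = ennreal s"
proof
  assume "(f has_sum s) UNIV"
  hence "f summable_on UNIV" and s: "s = infsum f UNIV" using has_sum_imp_summable infsumI by blast+
  hence "Infinite_Sum.abs_summable_on f UNIV" by (simp add: f)
  hence "Infinite_Set_Sum.abs_summable_on f UNIV" using abs_summable_equivalent by blast
  thus "(\<integral>\<^sup>+x. ennreal (f x) \<partial>count_space UNIV) = ennreal s"
    using nn_integral_conv_infsetsum[of f UNIV] f s infsetsum_infsum by fastforce
next
  assume *: "(\<integral>\<^sup>+x. ennreal (f x) \<partial>count_space UNIV) = ennreal s"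
  hence "integrable (count_space UNIV) f" by (intro integrableI_nonneg) (auto simp: f)
  hence a: "Infinite_Set_Sum.abs_summable_on f UNIV" by (simp add: Infinite_Set_Sum.abs_summable_on_def)
  hence "f summable_on UNIV"
    using abs_summable_equivalent Infinite_Sum.abs_summable_summable by blast
  moreover have "infsum f UNIV = s"
    using nn_integral_conv_infsetsum[OF a] f s * infsetsum_infsum[OF a]
    by (simp add: infsum_nonneg)
  ultimately show "(f has_sum s) UNIV" by (simp add: has_sum_infsum flip: \<open>infsum f UNIV = s\<close>)
qed

section \<open>Density of trigonometric polynomials\<close>

lemma finite_measure_unit: "finite_measure (lebesgue_on {0..1::real})"
  by (simp add: finite_measure_lebesgue_on)

lemma measure_unit [simp]: "measure (lebesgue_on {0..1::real}) {0..1} = 1"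
  by (simp add: measure_restrict_space)

lemma borel_measurable_unit:
  "f \<in> borel_measurable borel \<Longrightarrow> f \<in> borel_measurable (lebesgue_on {0..1::real})"
  by (intro measurable_restrict_space1 measurable_completion) simp

lemma trig_poly_bounded:
  assumes "trig_poly P"
  shows "P \<in> borel_measurable borel" "\<exists>B. \<forall>x. cmod (P x) \<le> B"
proof -
  show "P \<in> borel_measurable borel" using assms by induction auto
  show "\<exists>B. \<forall>x. cmod (P x) \<le> B" using assms
  proof induction
    case (monomial c m)
    show ?case by (rule exI[of _ "cmod c"]) (simp add: norm_mult)
  next
    case (add P Q)
    then obtain A B where "\<And>x. cmod (P x) \<le> A" "\<And>x. cmod (Q x) \<le> B" by blast
    hence "cmod (P x + Q x) \<le> A + B" for x by (rule norm_triangle_mono)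
    thus ?case by blast
  qed
qed

lemma square_integrable_trig_poly:
  "trig_poly P \<Longrightarrow> square_integrable (lebesgue_on {0..1}) P"
  using trig_poly_bounded[of P] finite_measure_unit
  by (metis borel_measurable_unit square_integrable_bounded)

text \<open>Dominated convergence with majorant \<open>|F|\<^sup>2\<close>.\<close>

lemma truncation_dense:
  assumes F: "square_integrable M F" and e: "e > 0"
  obtains n :: nat where "(\<integral>x. (cmod (F x - (if cmod (F x) \<le> n then F x else 0)))\<^sup>2 \<partial>M) < e"
proof -
  have [measurable]: "F \<in> borel_measurable M" using F by (simp add: square_integrable_def)
  have "(\<lambda>n::nat. \<integral>x. (cmod (F x - (if cmod (F x) \<le> n then F x else 0)))\<^sup>2 \<partial>M) \<longlonglongrightarrow> (\<integral>x. 0 \<partial>M)"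
  proof (rule integral_dominated_convergence)
    show "integrable M (\<lambda>x. (cmod (F x))\<^sup>2)" using F by (simp add: square_integrable_def)
    have "(\<lambda>n::nat. (cmod (F x - (if cmod (F x) \<le> n then F x else 0)))\<^sup>2) \<longlonglongrightarrow> 0" for x
    proof (rule tendsto_eventually)
      show "\<forall>\<^sub>F n in sequentially. (cmod (F x - (if cmod (F x) \<le> real n then F x else 0)))\<^sup>2 = 0"
        using eventually_ge_at_top[of "nat \<lceil>cmod (F x)\<rceil>"] 
      proof eventually_elim
        case (elim n)
        hence "cmod (F x) \<le> real n" by linarith
        thus ?case by simp
      qed
    qed
    thus "AE x in M. (\<lambda>n::nat. (cmod (F x - (if cmod (F x) \<le> n then F x else 0)))\<^sup>2) \<longlonglongrightarrow> 0" by simp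
  qed auto
  hence "\<forall>\<^sub>F n::nat in sequentially. (\<integral>x. (cmod (F x - (if cmod (F x) \<le> n then F x else 0)))\<^sup>2 \<partial>M) < e"
    using e by (intro order_tendstoD(2)) auto
  thus ?thesis using that by (auto simp: eventually_sequentially)
qed

text \<open>A continuous cutoff that vanishes near \<open>1\<close> and increases to \<open>1\<close> at every other point as \<open>n\<close> grows. It
  turns a continuous function on \<open>[0,1]\<close> with different end values into one on the circle.\<close>

definition away_from_one :: "nat \<Rightarrow> complex \<Rightarrow> real" where
  "away_from_one n z = min 1 (max 0 (n * cmod (z - 1) - 1))"

lemma away_from_one_bounds: "0 \<le> away_from_one n z" "away_from_one n z \<le> 1"
  by (auto simp: away_from_one_def)

text \<open>On the circle the argument jumps only at \<open>1\<close>, and the cutoff vanishes in a neighbourhood of that point.\<close>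

lemma continuous_on_circle_lift:
  fixes G :: "real \<Rightarrow> complex"
  assumes G: "continuous_on UNIV G"
  shows "continuous_on (sphere 0 1) (\<lambda>z. of_real (away_from_one n z) * G (Arg2pi z / (2 * pi)))"
    (is "continuous_on _ ?h")
proof (rule continuous_at_imp_continuous_on, rule ballI)
  fix z :: complex assume z: "z \<in> sphere 0 1"
  have w: "isCont (away_from_one n) z" for z
    unfolding away_from_one_def by (intro continuous_intros)
  show "isCont ?h z"
  proof (cases "z = 1")
    case False
    have "z \<notin> \<real>\<^sub>\<ge>\<^sub>0"
      using z False by (auto simp: complex_nonneg_Reals_iff cmod_def complex_eq_iff power2_eq_1_iff)
    hence "isCont (\<lambda>z. Arg2pi z / (2 * pi)) z" by (intro continuous_intros continuous_at_Arg2pi) auto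
    moreover have "isCont G (Arg2pi z / (2 * pi))" using G by (simp add: continuous_on_eq_continuous_at)
    ultimately have "isCont (\<lambda>z. G (Arg2pi z / (2 * pi))) z" by (rule isCont_o2)
    thus ?thesis using w by (intro continuous_intros)
  next
    case True
    have "\<forall>\<^sub>F y in nhds z. ?h y = 0"
    proof (rule eventually_nhds_metric[THEN iffD2, OF exI[of _ "1 / (1 + real n)"]], intro conjI allI impI)
      fix y assume "dist y z < 1 / (1 + real n)"
      hence "(1 + real n) * cmod (y - 1) < 1" using True by (simp add: dist_norm field_simps)
      hence "n * cmod (y - 1) \<le> 1" by (simp add: ring_distribs) (smt (verit) norm_ge_zero)
      thus "?h y = 0" by (simp add: away_from_one_def)
    qed simp
    hence "isCont ?h z \<longleftrightarrow> isCont (\<lambda>_. 0::complex) z" by (rule isCont_cong)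
    thus ?thesis by simp
  qed
qed

lemma Arg2pi_cis_turn: "0 \<le> x \<Longrightarrow> x < 1 \<Longrightarrow> Arg2pi (cis (2 * pi * x)) = 2 * pi * x"
  by (rule Arg2pi_unique[of 1]) (auto simp: cis_conv_exp)

text \<open>A Lebesgue measurable function is an almost everywhere limit of continuous functions. Projecting
  these onto the disc of radius \<open>B\<close> keeps them bounded, the cutoff makes them continuous on the circle,
  and by dominated convergence the resulting functions converge in \<open>L\<^sup>2\<close>; the circle version of
  Stone-Weierstrass finishes the approximation.\<close>

lemma bounded_approx_trig_poly:
  assumes F: "F \<in> borel_measurable (lebesgue_on {0..1})" and B: "\<And>x. cmod (F x) \<le> B" and e: "e > 0"
  obtains P where "trig_poly P" "(\<integral>x. (cmod (F x - P x))\<^sup>2 \<partial>lebesgue_on {0..1}) < e"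
proof -
  let ?M = "lebesgue_on {0..1::real}"
  interpret finite_measure ?M by (rule finite_measure_unit)
  have B0: "B \<ge> 0" using B[of 0] norm_ge_zero order_trans by blast
  have "F measurable_on {0..1}" using F by (simp add: measurable_on_iff_borel_measurable)
  then obtain N g where N: "negligible N" and g: "\<And>n. continuous_on UNIV (g n)"
    and lim: "\<And>x. x \<notin> N \<Longrightarrow> (\<lambda>n::nat. g n x) \<longlonglongrightarrow> (if x \<in> {0..1} then F x else 0)"
    unfolding measurable_on_def by blast
  \<comment> \<open>The nearest point projection is continuous and fixes the values of \<open>F\<close>, so it preserves the limit.\<close>
  define G where "G n x = closest_point (cball 0 B) (g n x)" for n x
  have cp: "continuous_on UNIV (closest_point (cball (0::complex) B))"
    using B0 by (intro continuous_on_closest_point) auto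
  have G: "continuous_on UNIV (G n)" for n
    unfolding G_def by (rule continuous_on_compose2[OF cp g]) auto
  have GB: "cmod (G n x) \<le> B" for n x
    using closest_point_in_set[of "cball 0 B" "g n x"] B0 by (auto simp: G_def)
  define H where "H n x = of_real (away_from_one n (cis (2 * pi * x))) * G n x" for n x
  have Hcont: "continuous_on UNIV (H n)" for n
    unfolding H_def away_from_one_def by (intro continuous_intros G)
  have HB: "cmod (H n x) \<le> B" for n x
    using mult_mono[OF away_from_one_bounds(2) GB] away_from_one_bounds B0
    by (simp add: H_def norm_mult)
  have Hm: "H n \<in> borel_measurable ?M" for n
    by (intro borel_measurable_unit borel_measurable_continuous_onI Hcont)
  have Hlim: "(\<lambda>n. H n x) \<longlonglongrightarrow> F x" if "x \<in> {0..1}" "x \<notin> N" "x \<noteq> 0" "x \<noteq> 1" for x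
  proof -
    have "(\<lambda>n. g n x) \<longlonglongrightarrow> F x" using lim[of x] that by auto
    hence "(\<lambda>n. G n x) \<longlonglongrightarrow> closest_point (cball 0 B) (F x)"
      unfolding G_def using cp by (intro isCont_tendsto_compose[of _ "closest_point (cball 0 B)"])
        (auto simp: continuous_on_eq_continuous_at)
    hence 1: "(\<lambda>n. G n x) \<longlonglongrightarrow> F x" using B[of x] by (simp add: closest_point_self)
    have "cis (2 * pi * x) \<noteq> 1"
    proof
      assume "cis (2 * pi * x) = 1"
      moreover have "Arg2pi 1 = 0" using Arg2pi_cis_turn[of 0] by simp
      ultimately show False using Arg2pi_cis_turn[of x] that by auto
    qed
    hence d: "cmod (cis (2 * pi * x) - 1) > 0" by simp
    have "(\<lambda>n::nat. away_from_one n (cis (2 * pi * x))) \<longlonglongrightarrow> 1"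
    proof (rule tendsto_eventually)
      show "\<forall>\<^sub>F n in sequentially. away_from_one n (cis (2 * pi * x)) = 1"
        using eventually_ge_at_top[of "nat \<lceil>2 / cmod (cis (2 * pi * x) - 1)\<rceil>"]
      proof eventually_elim
        case (elim n)
        hence "2 / cmod (cis (2 * pi * x) - 1) \<le> n" by linarith
        hence "2 \<le> n * cmod (cis (2 * pi * x) - 1)" using d by (simp add: field_simps)
        thus ?case by (simp add: away_from_one_def)
      qed
    qed
    from tendsto_mult[OF tendsto_of_real[OF this] 1] show ?thesis by (simp add: H_def)
  qed
  have ae: "AE x in ?M. x \<in> {0..1} \<and> x \<notin> N \<and> x \<noteq> 0 \<and> x \<noteq> 1"
  proof -
    have "AE x in lebesgue. x \<notin> N \<union> {0,1}"
      by (rule AE_not_in) (use N in \<open>auto simp: negligible_iff_null_sets intro!: null_sets.insert_in_sets\<close>)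
    thus ?thesis by (subst AE_restrict_space_iff) auto
  qed
  have "(\<lambda>n. \<integral>x. (cmod (F x - H n x))\<^sup>2 \<partial>?M) \<longlonglongrightarrow> (\<integral>x. 0 \<partial>?M)"
  proof (rule integral_dominated_convergence)
    show "integrable ?M (\<lambda>x. (2 * B)\<^sup>2)" by simp
    show "AE x in ?M. (\<lambda>n. (cmod (F x - H n x))\<^sup>2) \<longlonglongrightarrow> 0"
      using ae
    proof eventually_elim
      case (elim x)
      have "(\<lambda>n. (cmod (F x - H n x))\<^sup>2) \<longlonglongrightarrow> (cmod (F x - F x))\<^sup>2"
        by (intro tendsto_intros Hlim) (use elim in auto)
      thus ?case by simp
    qed
    show "AE x in ?M. norm ((cmod (F x - H n x))\<^sup>2) \<le> (2 * B)\<^sup>2" for n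
    proof (rule AE_I2)
      fix x
      have "cmod (F x - H n x) \<le> 2 * B"
        using norm_triangle_ineq4[of "F x" "H n x"] B[of x] HB[of n x] by linarith
      from power_mono[OF this norm_ge_zero, of 2]
      show "norm ((cmod (F x - H n x))\<^sup>2) \<le> (2 * B)\<^sup>2" by simp
    qed
  qed (use F Hm in measurable)
  hence "\<forall>\<^sub>F n in sequentially. (\<integral>x. (cmod (F x - H n x))\<^sup>2 \<partial>?M) < e / 4"
    using e by (intro order_tendstoD(2)) auto
  then obtain n where n: "(\<integral>x. (cmod (F x - H n x))\<^sup>2 \<partial>?M) < e / 4"
    by (auto simp: eventually_sequentially)
  \<comment> \<open>Both squared distances are doubled in the end, so \<open>e / 4\<close> and \<open>d\<^sup>2 = e / 8\<close> leave a margin.\<close>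
  define d where "d = sqrt (e / 8)"
  have d: "d > 0" "d\<^sup>2 = e / 8" using e by (auto simp: d_def)
  obtain P where P: "trig_poly P" "\<And>x. cmod (of_real (away_from_one n (cis (2 * pi * x))) *
      G n (Arg2pi (cis (2 * pi * x)) / (2 * pi)) - P x) < d"
    using trig_poly_dense_circle[OF continuous_on_circle_lift[OF G] d(1)] by blast
  have HP: "cmod (H n x - P x) < d" if "x \<in> {0..1}" for x
  proof (cases "x = 1")
    case True
    thus ?thesis using P(2)[of 1] by (simp add: H_def away_from_one_def)
  next
    case False
    thus ?thesis using P(2)[of x] that Arg2pi_cis_turn[of x] by (simp add: H_def)
  qed
  have "(\<integral>x. (cmod (H n x - P x))\<^sup>2 \<partial>?M) \<le> (\<integral>x. d\<^sup>2 \<partial>?M)"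
  proof (rule integral_mono)
    have "square_integrable ?M (\<lambda>x. H n x - P x)"
      by (intro square_integrable_diff square_integrable_trig_poly P square_integrable_bounded[where B = B]
          finite_measure_unit Hm HB)
    thus "integrable ?M (\<lambda>x. (cmod (H n x - P x))\<^sup>2)" by (simp add: square_integrable_def)
    fix x assume "x \<in> space ?M"
    thus "(cmod (H n x - P x))\<^sup>2 \<le> d\<^sup>2" using HP[of x] by (intro power_mono) auto
  qed simp
  hence "(\<integral>x. (cmod (H n x - P x))\<^sup>2 \<partial>?M) \<le> e / 8" using d by simp
  moreover have "(\<integral>x. (cmod (F x - P x))\<^sup>2 \<partial>?M)
    \<le> 2 * (\<integral>x. (cmod (F x - H n x))\<^sup>2 \<partial>?M) + 2 * (\<integral>x. (cmod (H n x - P x))\<^sup>2 \<partial>?M)"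
    by (intro integral_norm_diff_square_le square_integrable_trig_poly P
        square_integrable_bounded[where B = B] finite_measure_unit Hm HB F B)
  ultimately have "(\<integral>x. (cmod (F x - P x))\<^sup>2 \<partial>?M) < e" using n e by linarith
  with P show ?thesis using that by blast
qed

lemma trig_poly_dense_L2:
  assumes F: "square_integrable (lebesgue_on {0..1}) F" and e: "e > 0"
  obtains P where "trig_poly P" "(\<integral>x. (cmod (F x - P x))\<^sup>2 \<partial>lebesgue_on {0..1}) < e"
proof -
  let ?M = "lebesgue_on {0..1::real}"
  have [measurable]: "F \<in> borel_measurable ?M" using F by (simp add: square_integrable_def)
  obtain n :: nat where n: "(\<integral>x. (cmod (F x - (if cmod (F x) \<le> n then F x else 0)))\<^sup>2 \<partial>?M) < e / 4"
    using truncation_dense[OF F, of "e / 4"] e by auto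
  let ?G = "\<lambda>x. if cmod (F x) \<le> n then F x else 0"
  have G: "?G \<in> borel_measurable ?M" "\<And>x. cmod (?G x) \<le> n" by auto
  obtain P where P: "trig_poly P" "(\<integral>x. (cmod (?G x - P x))\<^sup>2 \<partial>?M) < e / 4"
    using bounded_approx_trig_poly[OF G, of "e / 4"] e by auto
  have "(\<integral>x. (cmod (F x - P x))\<^sup>2 \<partial>?M)
    \<le> 2 * (\<integral>x. (cmod (F x - ?G x))\<^sup>2 \<partial>?M) + 2 * (\<integral>x. (cmod (?G x - P x))\<^sup>2 \<partial>?M)"
    by (intro integral_norm_diff_square_le F square_integrable_trig_poly P
        square_integrable_bounded[where B = "real n"] finite_measure_unit G)
  also have "\<dots> < e" using n P(2) by linarith
  finally show ?thesis using that P by blast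
qed

section \<open>The Parseval identity for Fourier series\<close>

definition fourier_coeff :: "(real \<Rightarrow> complex) \<Rightarrow> int \<Rightarrow> complex" where
  "fourier_coeff F m = (\<integral>x. F x * cnj (fourier_char m x) \<partial>lebesgue_on {0..1})"

lemma square_integrable_fourier_char: "square_integrable (lebesgue_on {0..1}) (fourier_char m)"
  using square_integrable_trig_poly[OF trig_poly.monomial[of 1 m]] by simp

lemma integrable_times_cnj_char:
  assumes "square_integrable (lebesgue_on {0..1}) F"
  shows "integrable (lebesgue_on {0..1}) (\<lambda>x. F x * cnj (fourier_char m x))"
  by (intro square_integrable_mult_integrable square_integrable_cnj assms square_integrable_fourier_char)

text \<open>Pythagoras for the orthonormal characters. Choosing \<open>p\<close> as the Fourier coefficients gives Bessel's
  inequality, and dropping the last sum says that no choice of \<open>p\<close> approximates better.\<close>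

lemma integral_diff_trig_poly:
  assumes F: "square_integrable (lebesgue_on {0..1}) F" and K: "finite K"
  shows "(\<integral>x. (cmod (F x - (\<Sum>m\<in>K. p m * fourier_char m x)))\<^sup>2 \<partial>lebesgue_on {0..1})
    = (\<integral>x. (cmod (F x))\<^sup>2 \<partial>lebesgue_on {0..1}) - (\<Sum>m\<in>K. (cmod (fourier_coeff F m))\<^sup>2)
      + (\<Sum>m\<in>K. (cmod (fourier_coeff F m - p m))\<^sup>2)"
proof -
  let ?M = "lebesgue_on {0..1::real}"
  define P where "P x = (\<Sum>m\<in>K. p m * fourier_char m x)" for x
  have Pm [measurable]: "P \<in> borel_measurable ?M"
    unfolding P_def[abs_def] by (intro borel_measurable_unit) measurable
  have PB: "cmod (P x) \<le> (\<Sum>m\<in>K. cmod (p m))" for x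
    unfolding P_def by (rule sum_norm_le) (simp add: norm_mult)
  have P: "square_integrable ?M P"
    using square_integrable_bounded[OF finite_measure_unit Pm PB] .
  have coeff: "(\<integral>x. G x * cnj (P x) \<partial>?M) = (\<Sum>m\<in>K. fourier_coeff G m * cnj (p m))"
    if G: "square_integrable ?M G" for G
  proof -
    have "(\<integral>x. G x * cnj (P x) \<partial>?M) = (\<integral>x. (\<Sum>m\<in>K. G x * cnj (fourier_char m x) * cnj (p m)) \<partial>?M)"
      by (simp add: P_def sum_distrib_left mult_ac)
    also have "\<dots> = (\<Sum>m\<in>K. fourier_coeff G m * cnj (p m))"
      using integrable_times_cnj_char[OF G] unfolding fourier_coeff_def
      by (subst Bochner_Integration.integral_sum) auto
    finally show ?thesis .
  qed
  have coeffP: "fourier_coeff P n = p n" if "n \<in> K" for n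
  proof -
    have "fourier_coeff P n = (\<integral>x. (\<Sum>m\<in>K. p m * (fourier_char m x * cnj (fourier_char n x))) \<partial>?M)"
      by (simp only: fourier_coeff_def P_def sum_distrib_right mult.assoc)
    also have "\<dots> = (\<Sum>m\<in>K. p m * (if m = n then 1 else 0))"
      using integrable_times_cnj_char[OF square_integrable_fourier_char]
      by (subst Bochner_Integration.integral_sum) (auto simp: orthonormal_fourier_char)
    also have "\<dots> = p n" using K that by (simp add: sum.delta' if_distrib[of "\<lambda>z. _ * z"] cong: if_cong)
    finally show ?thesis .
  qed
  have iFP: "integrable ?M (\<lambda>x. F x * cnj (P x))"
    by (intro square_integrable_mult_integrable square_integrable_cnj F P)
  have iPP: "integrable ?M (\<lambda>x. P x * cnj (P x))"
    by (intro square_integrable_mult_integrable square_integrable_cnj P)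
  have iF: "integrable ?M (\<lambda>x. (cmod (F x))\<^sup>2)" using F by (simp add: square_integrable_def)
  have expand: "(cmod (a - b))\<^sup>2 = (cmod a)\<^sup>2 - 2 * Re (a * cnj b) + Re (b * cnj b)" for a b
    by (simp only: cmod_power2) (simp add: power2_eq_square algebra_simps)
  have lin: "(\<integral>x. a x - 2 * b x + c x \<partial>?M) = (\<integral>x. a x \<partial>?M) - 2 * (\<integral>x. b x \<partial>?M) + (\<integral>x. c x \<partial>?M)"
    if "integrable ?M a" "integrable ?M b" "integrable ?M c" for a b c :: "real \<Rightarrow> real"
    using that by simp
  have "(\<integral>x. (cmod (F x - P x))\<^sup>2 \<partial>?M)
    = (\<integral>x. (cmod (F x))\<^sup>2 - 2 * Re (F x * cnj (P x)) + Re (P x * cnj (P x)) \<partial>?M)"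
    by (simp only: expand)
  also have "\<dots> = (\<integral>x. (cmod (F x))\<^sup>2 \<partial>?M) - 2 * Re (\<integral>x. F x * cnj (P x) \<partial>?M)
      + Re (\<integral>x. P x * cnj (P x) \<partial>?M)"
    unfolding integral_Re[OF iFP, symmetric] integral_Re[OF iPP, symmetric]
    by (rule lin[OF iF integrable_Re[OF iFP] integrable_Re[OF iPP]])
  also have "\<dots> = (\<integral>x. (cmod (F x))\<^sup>2 \<partial>?M)
      + (\<Sum>m\<in>K. Re (p m * cnj (p m)) - 2 * Re (fourier_coeff F m * cnj (p m)))"
    using coeffP by (simp add: coeff F P sum_subtractf sum_distrib_left)
  also have "(\<Sum>m\<in>K. Re (p m * cnj (p m)) - 2 * Re (fourier_coeff F m * cnj (p m)))
      = (\<Sum>m\<in>K. (cmod (fourier_coeff F m - p m))\<^sup>2 - (cmod (fourier_coeff F m))\<^sup>2)"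
    by (intro sum.cong refl) (subst expand, simp)
  finally show ?thesis by (simp add: P_def sum_subtractf)
qed

text \<open>Bessel's inequality bounds the sum from above; the best approximation property together with the
  density of trigonometric polynomials bounds it from below.\<close>

theorem fourier_parseval_unit:
  assumes F: "square_integrable (lebesgue_on {0..1}) F"
  shows "((\<lambda>m. (cmod (fourier_coeff F m))\<^sup>2) has_sum (\<integral>x. (cmod (F x))\<^sup>2 \<partial>lebesgue_on {0..1})) UNIV"
proof -
  let ?S = "\<integral>x. (cmod (F x))\<^sup>2 \<partial>lebesgue_on {0..1}"
  let ?a = "\<lambda>m. (cmod (fourier_coeff F m))\<^sup>2"
  have bessel: "sum ?a K \<le> ?S" if "finite K" for K
  proof -
    have "0 \<le> (\<integral>x. (cmod (F x - (\<Sum>m\<in>K. fourier_coeff F m * fourier_char m x)))\<^sup>2 \<partial>lebesgue_on {0..1})"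
      by (rule Bochner_Integration.integral_nonneg) simp
    thus ?thesis by (simp add: integral_diff_trig_poly[OF F that])
  qed
  have summ: "?a summable_on UNIV"
    by (rule nonneg_bdd_above_summable_on) (auto intro!: bdd_aboveI[of _ ?S] bessel)
  have "infsum ?a UNIV \<le> ?S"
    by (intro infsum_le_finite_sums summ) (auto intro: bessel)
  moreover have "?S \<le> infsum ?a UNIV"
  proof (rule field_le_epsilon)
    fix e :: real assume "e > 0"
    then obtain P where P: "trig_poly P" "(\<integral>x. (cmod (F x - P x))\<^sup>2 \<partial>lebesgue_on {0..1}) < e"
      using trig_poly_dense_L2[OF F] by blast
    then obtain K p where K: "finite K" "P = (\<lambda>x. \<Sum>m\<in>K. p m * fourier_char m x)"
      using trig_poly_eq_sum by blast
    have "?S - sum ?a K \<le> (\<integral>x. (cmod (F x - P x))\<^sup>2 \<partial>lebesgue_on {0..1})"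
      unfolding K(2) integral_diff_trig_poly[OF F K(1)] by (simp add: sum_nonneg)
    moreover have "sum ?a K \<le> infsum ?a UNIV"
      by (intro finite_sum_le_infsum summ K) auto
    ultimately show "?S \<le> infsum ?a UNIV + e" using P(2) by linarith
  qed
  ultimately show ?thesis using summ has_sum_infsum by (metis antisym)
qed

text \<open>The part of \<open>h\<close> on \<open>[-1,0]\<close> is moved to \<open>[0,1]\<close> by translation.\<close>

lemma integral_fold_unit:
  fixes h :: "real \<Rightarrow> 'b::euclidean_space"
  assumes h: "integrable lborel h" and supp: "AE x in lborel. h x \<noteq> 0 \<longrightarrow> x \<in> {-1..1}"
  shows "integrable (lebesgue_on {0..1}) (\<lambda>x. h x + h (x - 1))"
    and "(\<integral>x. h x + h (x - 1) \<partial>lebesgue_on {0..1}) = integral\<^sup>L lborel h"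
proof -
  have hm [measurable]: "h \<in> borel_measurable borel"
    using borel_measurable_integrable[OF h] by simp
  have shift: "integrable lborel (\<lambda>x. f (x - 1)) \<and> (\<integral>x. f (x - 1) \<partial>lborel) = integral\<^sup>L lborel f"
    if "integrable lborel f" for f :: "real \<Rightarrow> 'b"
    using lborel_integrable_real_affine[OF that, of 1 "-1"] lborel_integral_real_affine[of 1 f "-1"]
    by simp
  let ?a = "\<lambda>x. indicator {0..1} x *\<^sub>R h x" and ?b = "\<lambda>x. indicator {0..1} (x + 1) *\<^sub>R h x"
  have a: "integrable lborel ?a" using h by (intro integrable_mult_indicator) auto
  have "{x. x + 1 \<in> {0..1::real}} = {-1..0}" by auto
  hence "?b = (\<lambda>x. indicator {-1..0} x *\<^sub>R h x)" by (auto simp: indicator_def fun_eq_iff)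
  hence b: "integrable lborel ?b" using h by (auto intro!: integrable_mult_indicator)
  have eq: "indicator {0..1} x *\<^sub>R (h x + h (x - 1)) = ?a x + ?b (x - 1)" for x
    by (auto simp: indicator_def)
  have m: "(\<lambda>x. ?a x + ?b (x - 1)) \<in> borel_measurable lborel"
    by measurable
  have "integrable lborel (\<lambda>x. ?a x + ?b (x - 1))"
    using a shift[OF b] by (intro Bochner_Integration.integrable_add) auto
  thus "integrable (lebesgue_on {0..1}) (\<lambda>x. h x + h (x - 1))"
    by (subst integrable_restrict_space) (simp, simp only: eq integrable_completion[OF m])
  have "(\<integral>x. h x + h (x - 1) \<partial>lebesgue_on {0..1}) = (\<integral>x. ?a x + ?b (x - 1) \<partial>lborel)"
    by (subst integral_restrict_space) (simp, simp only: eq integral_completion[OF m])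
  also have "\<dots> = (\<integral>x. ?a x \<partial>lborel) + (\<integral>x. ?b x \<partial>lborel)"
    using a shift[OF b] by (subst Bochner_Integration.integral_add) auto
  also have "\<dots> = (\<integral>x. ?a x + ?b x \<partial>lborel)"
    using a b by (subst Bochner_Integration.integral_add) auto
  also have "\<dots> = integral\<^sup>L lborel h"
  proof (rule integral_cong_AE)
    show "AE x in lborel. ?a x + ?b x = h x"
      using supp AE_lborel_singleton[of 0]
      by eventually_elim (auto simp: indicator_def)
  qed measurable
  finally show "(\<integral>x. h x + h (x - 1) \<partial>lebesgue_on {0..1}) = integral\<^sup>L lborel h" .
qed

text \<open>The folded function \<open>F x + F (x - 1)\<close> on \<open>[0,1]\<close> has the same Fourier coefficients as \<open>F\<close>, because the
  characters have period \<open>1\<close>, and the same norm, because at almost every point one of its two terms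
  vanishes.\<close>

theorem fourier_parseval_disjoint_translates:
  assumes F: "square_integrable lborel F"
    and supp: "AE x in lborel. F x \<noteq> 0 \<longrightarrow> x \<in> {-1..1}"
    and disj: "AE x in lborel. F x = 0 \<or> F (x + 1) = 0"
  shows "(\<integral>\<^sup>+m. ennreal ((cmod (\<integral>x. F x * cnj (fourier_char m x) \<partial>lborel))\<^sup>2) \<partial>count_space UNIV)
    = (\<integral>\<^sup>+x. ennreal ((cmod (F x))\<^sup>2) \<partial>lborel)"
proof -
  let ?M = "lebesgue_on {0..1::real}"
  have [measurable]: "F \<in> borel_measurable borel" and iF: "integrable lborel (\<lambda>x. (cmod (F x))\<^sup>2)"
    using F by (auto simp: square_integrable_def)
  define P where "P x = F x + F (x - 1)" for x
  have Pm [measurable]: "P \<in> borel_measurable borel" unfolding P_def[abs_def] by measurable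
  have int: "integrable lborel (\<lambda>x. F x * cnj (fourier_char m x))" for m
  proof -
    have "square_integrable lborel (\<lambda>x. indicator {-1..1} x * cnj (fourier_char m x))"
      unfolding square_integrable_def
    proof
      have "(\<lambda>x. (cmod (indicator {-1..1} x * cnj (fourier_char m x)))\<^sup>2) = indicator {-1..1}"
        by (auto simp: indicator_def fun_eq_iff norm_mult)
      thus "integrable lborel (\<lambda>x. (cmod (indicator {-1..1} x * cnj (fourier_char m x)))\<^sup>2)" by simp
    qed measurable
    hence "integrable lborel (\<lambda>x. F x * (indicator {-1..1} x * cnj (fourier_char m x)))"
      by (rule square_integrable_mult_integrable[OF F])
    moreover have "AE x in lborel. F x * (indicator {-1..1} x * cnj (fourier_char m x)) = F x * cnj (fourier_char m x)"
      using supp by eventually_elim (auto simp: indicator_def)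
    ultimately show ?thesis by (subst (asm) integrable_cong_AE) auto
  qed
  have coeff: "fourier_coeff P m = (\<integral>x. F x * cnj (fourier_char m x) \<partial>lborel)" for m
  proof -
    have "fourier_char m (x - 1) = fourier_char m x" for x
      using fourier_char_add_arg[of m "x - 1" 1] fourier_char_of_int[of m 1] by simp
    hence "fourier_coeff P m = (\<integral>x. F x * cnj (fourier_char m x) +
        F (x - 1) * cnj (fourier_char m (x - 1)) \<partial>?M)"
      by (simp add: fourier_coeff_def P_def ring_distribs)
    also have "\<dots> = (\<integral>x. F x * cnj (fourier_char m x) \<partial>lborel)"
      by (rule integral_fold_unit(2)[OF int]) (use supp in \<open>eventually_elim, auto\<close>)
    finally show ?thesis .
  qed
  have supp2: "AE x in lborel. (cmod (F x))\<^sup>2 \<noteq> 0 \<longrightarrow> x \<in> {-1..1}"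
    using supp by eventually_elim auto
  have "AE x in lborel. F (x - 1) = 0 \<or> F x = 0"
  proof -
    have "AE x in lborel. F (- 1 + 1 * x) = 0 \<or> F (- 1 + 1 * x + 1) = 0"
      by (rule AE_borel_affine) (use disj in auto)
    thus ?thesis by (simp add: add.commute)
  qed
  hence "AE x in lebesgue. F (x - 1) = 0 \<or> F x = 0" by (rule AE_completion)
  hence ae: "AE x in ?M. (cmod (P x))\<^sup>2 = (cmod (F x))\<^sup>2 + (cmod (F (x - 1)))\<^sup>2"
    by (subst AE_restrict_space_iff) (auto simp: P_def elim!: eventually_mono)
  have m: "P \<in> borel_measurable ?M" "F \<in> borel_measurable ?M" "(\<lambda>x. F (x - 1)) \<in> borel_measurable ?M"
    by (intro borel_measurable_unit, measurable)+
  have m1: "(\<lambda>x. (cmod (P x))\<^sup>2) \<in> borel_measurable ?M"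
    "(\<lambda>x. (cmod (F x))\<^sup>2 + (cmod (F (x - 1)))\<^sup>2) \<in> borel_measurable ?M"
    using m by measurable
  have P: "square_integrable ?M P"
    unfolding square_integrable_def
    using m integrable_cong_AE[OF m1 ae] integral_fold_unit(1)[OF iF supp2] by simp
  have "((\<lambda>m. (cmod (fourier_coeff P m))\<^sup>2) has_sum (\<integral>x. (cmod (F x))\<^sup>2 \<partial>lborel)) UNIV"
    using fourier_parseval_unit[OF P] integral_cong_AE[OF m1 ae] integral_fold_unit(2)[OF iF supp2]
    by simp
  hence "(\<integral>\<^sup>+m. ennreal ((cmod (fourier_coeff P m))\<^sup>2) \<partial>count_space UNIV)
      = ennreal (\<integral>x. (cmod (F x))\<^sup>2 \<partial>lborel)"
    by (subst (asm) has_sum_iff_nn_integral) (auto intro: Bochner_Integration.integral_nonneg)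
  also have "\<dots> = (\<integral>\<^sup>+x. ennreal ((cmod (F x))\<^sup>2) \<partial>lborel)"
    by (rule nn_integral_eq_integral[symmetric]) (use iF in auto)
  finally show ?thesis by (simp add: coeff)
qed

section \<open>Lebesgue measure on the plane\<close>

lemma borel_fst_snd [measurable]:
  "fst \<in> borel_measurable (borel :: (real \<times> real) measure)"
  "snd \<in> borel_measurable (borel :: (real \<times> real) measure)"
  by (intro borel_measurable_continuous_onI continuous_intros)+

lemma borel_measurable_cis [measurable]: "cis \<in> borel_measurable borel"
  by (intro borel_measurable_continuous_onI continuous_intros)

lemma borel_measurable_lebesgueI:
  fixes f :: "'a::euclidean_space \<Rightarrow> 'b::topological_space"
  shows "f \<in> borel_measurable borel \<Longrightarrow> f \<in> borel_measurable lebesgue"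
  by (rule measurable_completion) simp

lemma null_sets_Times_UNIV:
  fixes T :: "real set"
  assumes "T \<in> null_sets lebesgue"
  shows "T \<times> (UNIV :: real set) \<in> null_sets lebesgue"
proof -
  obtain T' where T': "T' \<in> null_sets lborel" "T \<subseteq> T'"
    using assms by (auto simp: null_sets_completion_iff2)
  have "T' \<times> (UNIV :: real set) \<in> null_sets (lborel \<Otimes>\<^sub>M lborel)"
    using T'(1) lborel.emeasure_pair_measure_Times[of T' lborel "UNIV :: real set"]
    by (auto simp: null_sets_def)
  hence "T' \<times> (UNIV :: real set) \<in> null_sets lborel" by (simp add: lborel_prod)
  moreover have "T \<times> (UNIV :: real set) \<subseteq> T' \<times> UNIV" using T'(2) by blast
  ultimately show ?thesis unfolding null_sets_completion_iff2 by blast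
qed

lemma lebesgue_borel_core:
  fixes S :: "'a::euclidean_space set"
  assumes "S \<in> sets lebesgue"
  obtains C T where "C \<in> sets borel" "T \<in> null_sets lebesgue" "C \<union> T = S"
proof -
  obtain C T where C: "fsigma C" "T \<in> null_sets lebesgue" "C \<union> T = S"
    using lebesgue_set_almost_fsigma[OF assms] by metis
  from C(1) have "C \<in> sets borel" by cases auto
  with C show ?thesis using that by blast
qed

lemma sets_lebesgue_Times_UNIV:
  fixes I :: "real set"
  assumes "I \<in> sets lebesgue"
  shows "I \<times> (UNIV :: real set) \<in> sets lebesgue"
proof -
  obtain C T where C: "C \<in> sets borel" and T: "T \<in> null_sets lebesgue" and CT: "C \<union> T = I"
    using lebesgue_borel_core[OF assms] by metis
  have "fst -` C \<inter> space borel \<in> sets (borel :: (real \<times> real) measure)"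
    by (rule measurable_sets[OF borel_fst_snd(1) C])
  moreover have "fst -` C \<inter> space borel = C \<times> (UNIV :: real set)" by auto
  ultimately have "C \<times> (UNIV :: real set) \<in> sets lebesgue" by (intro sets_completionI_sets) simp
  moreover have "T \<times> (UNIV :: real set) \<in> sets lebesgue"
    using null_sets_Times_UNIV[OF T] by blast
  ultimately have "C \<times> UNIV \<union> T \<times> (UNIV :: real set) \<in> sets lebesgue" by (rule sets.Un)
  moreover have "C \<times> UNIV \<union> T \<times> (UNIV :: real set) = I \<times> UNIV" using CT by blast
  ultimately show ?thesis by simp
qed

lemma lborel_AE_shift:
  fixes c :: "'a::euclidean_space"
  assumes "AE z in lborel. P z"
  shows "AE z in lborel. P (z - c)"
proof -
  obtain N where N: "N \<in> null_sets lborel" "{z. \<not> P z} \<subseteq> N"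
    using assms by (auto simp: eventually_ae_filter)
  have "AE z in distr lborel borel ((+) (- c)). z \<notin> N"
    unfolding lborel_distr_plus using N(1) by (rule AE_not_in)
  hence "AE z in lborel. - c + z \<notin> N"
    by (subst (asm) AE_distr_iff) (use N(1) in auto)
  thus ?thesis by eventually_elim (use N(2) in auto)
qed

lemma lborel_integrable_shift:
  fixes h :: "'a::euclidean_space \<Rightarrow> 'b::{banach, second_countable_topology}"
  assumes "integrable lborel h"
  shows "integrable lborel (\<lambda>z. h (z - c))"
proof -
  have "integrable (distr lborel borel ((+) (- c))) h" using assms by (simp add: lborel_distr_plus)
  thus ?thesis using assms borel_measurable_integrable[OF assms]
    by (subst (asm) integrable_distr_eq) auto
qed

lemma lebesgue_shift_measurable:
  fixes c :: "'a::euclidean_space"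
  shows "(\<lambda>z. z - c) \<in> lebesgue \<rightarrow>\<^sub>M lebesgue"
  using lebesgue_affine_measurable[of "\<lambda>_. 1" "- c"] by (simp add: euclidean_representation)

lemma AE_lborel_pair:
  assumes "AE z in (lborel :: (real \<times> real) measure). P z"
  shows "AE x in lborel. AE y in lborel. P (x, y)"
proof -
  have "AE z in (lborel \<Otimes>\<^sub>M lborel :: (real \<times> real) measure). P z"
    using assms by (simp only: lborel_prod)
  thus ?thesis by (rule lborel_pair.AE_pair)
qed

lemma null_sets_shift:
  fixes N :: "'a::euclidean_space set"
  assumes "N \<in> null_sets lebesgue"
  shows "{x. x + c \<in> N} \<in> null_sets lebesgue"
proof -
  have "AE x in lborel. x \<notin> N" using AE_not_in[OF assms] by (simp only: AE_completion_iff)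
  hence "AE x in lborel. x - (- c) \<notin> N" by (rule lborel_AE_shift)
  hence "AE x in lebesgue. x + c \<notin> N" by (intro AE_completion) simp
  moreover have "{x. x + c \<in> N} \<in> sets lebesgue"
    using measurable_sets[OF lebesgue_shift_measurable[of "- c"], of N] assms by (auto simp: vimage_def)
  ultimately show ?thesis by (simp add: AE_iff_null_sets)
qed

lemma null_sets_mono_lebesgue:
  assumes "N \<in> null_sets lebesgue" "M \<subseteq> N"
  shows "M \<in> null_sets lebesgue"
  using assms unfolding null_sets_completion_iff2 by blast

section \<open>Removing the weight of the field measure\<close>

text \<open>The map \<open>f \<mapsto> weighted I f\<close> is an isometry from \<open>L\<^sup>2(I \<times> \<real>)\<close> with the measure \<open>|\<xi>| d\<xi> dt\<close> into \<open>L\<^sup>2\<close> of the plane.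
  The factor \<open>|\<xi>|\<^sup>1\<^sup>/\<^sup>2\<close> is also the one in the definition of a Gabor field: over each \<open>\<xi>\<close> in \<open>I\<close> the fibre of
  \<open>weighted I g\<close> is the function whose translates and modulates form the Parseval frame.\<close>

definition weighted :: "real set \<Rightarrow> (real \<times> real \<Rightarrow> complex) \<Rightarrow> real \<times> real \<Rightarrow> complex" where
  "weighted I f z = (indicator I (fst z) * sqrt \<bar>fst z\<bar>) *\<^sub>R f z"

lemma field_measurable_iff:
  fixes f :: "real \<times> real \<Rightarrow> complex"
  assumes "I \<in> sets lebesgue"
  shows "f \<in> borel_measurable (field_measure I) \<longleftrightarrow>
    (\<lambda>z. indicator (I \<times> UNIV) z *\<^sub>R f z) \<in> borel_measurable lebesgue"
proof -
  have "f \<in> borel_measurable (field_measure I) \<longleftrightarrow> f \<in> borel_measurable (lebesgue_on (I \<times> UNIV))"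
    unfolding field_measure_def by (intro arg_cong2[of _ _ _ _ "(\<in>)"] refl measurable_cong_sets) auto
  thus ?thesis
    by (simp add: borel_measurable_restrict_space_iff sets_lebesgue_Times_UNIV[OF assms])
qed

lemma
  fixes h :: "real \<times> real \<Rightarrow> 'b::{banach, second_countable_topology}"
  assumes I: "I \<in> sets lebesgue" and h: "h \<in> borel_measurable (field_measure I)"
  shows integrable_field_measure: "integrable (field_measure I) h \<longleftrightarrow>
      integrable lebesgue (\<lambda>z. (indicator I (fst z) * \<bar>fst z\<bar>) *\<^sub>R h z)"
    and integral_field_measure: "integral\<^sup>L (field_measure I) h =
      integral\<^sup>L lebesgue (\<lambda>z. (indicator I (fst z) * \<bar>fst z\<bar>) *\<^sub>R h z)"
proof -
  let ?L = "lebesgue_on (I \<times> (UNIV :: real set))"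
  have eq: "field_measure I = density ?L (\<lambda>z. ennreal \<bar>fst z\<bar>)"
    unfolding field_measure_def by (rule arg_cong[of _ _ "density ?L"]) auto
  have hL: "h \<in> borel_measurable ?L"
    using h unfolding field_measure_def by (subst measurable_cong_sets) auto
  have f: "(\<lambda>z. \<bar>fst z\<bar>) \<in> borel_measurable ?L"
    by (intro measurable_restrict_space1 borel_measurable_lebesgueI) measurable
  have ind: "indicator (I \<times> UNIV) z *\<^sub>R (\<bar>fst z\<bar> *\<^sub>R h z) = (indicator I (fst z) * \<bar>fst z\<bar>) *\<^sub>R h z" for z
    by (cases z) (auto simp: indicator_def)
  show "integrable (field_measure I) h \<longleftrightarrow>
      integrable lebesgue (\<lambda>z. (indicator I (fst z) * \<bar>fst z\<bar>) *\<^sub>R h z)"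
    unfolding eq using I
    by (subst integrable_density[OF hL f], simp, subst integrable_restrict_space)
      (simp_all add: sets_lebesgue_Times_UNIV ind del: scaleR_scaleR)
  show "integral\<^sup>L (field_measure I) h =
      integral\<^sup>L lebesgue (\<lambda>z. (indicator I (fst z) * \<bar>fst z\<bar>) *\<^sub>R h z)"
    unfolding eq using I
    by (subst integral_density[OF hL f], simp, subst integral_restrict_space)
      (simp_all add: sets_lebesgue_Times_UNIV ind del: scaleR_scaleR)
qed

lemma weighted_measurable:
  assumes I: "I \<in> sets lebesgue" and f: "f \<in> borel_measurable (field_measure I)"
  shows "weighted I f \<in> borel_measurable lebesgue"
proof -
  have eq: "weighted I f = (\<lambda>z. sqrt \<bar>fst z\<bar> *\<^sub>R (indicator (I \<times> UNIV) z *\<^sub>R f z))"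
    by (auto simp: weighted_def fun_eq_iff indicator_def)
  have "(\<lambda>z::real \<times> real. sqrt \<bar>fst z\<bar>) \<in> borel_measurable lebesgue"
    by (intro borel_measurable_lebesgueI) measurable
  thus ?thesis unfolding eq using f[unfolded field_measurable_iff[OF I]]
    by (rule borel_measurable_scaleR)
qed

lemma norm_weighted_square:
  "(cmod (weighted I f z))\<^sup>2 = indicator I (fst z) * \<bar>fst z\<bar> * (cmod (f z))\<^sup>2"
  by (auto simp: weighted_def indicator_def power_mult_distrib)

lemma square_integrable_field_iff:
  assumes I: "I \<in> sets lebesgue"
  shows "square_integrable (field_measure I) f \<longleftrightarrow>
    f \<in> borel_measurable (field_measure I) \<and> integrable lebesgue (\<lambda>z. (cmod (weighted I f z))\<^sup>2)"
proof (cases "f \<in> borel_measurable (field_measure I)")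
  case True
  have "(\<lambda>x. (cmod (f x))\<^sup>2) \<in> borel_measurable (field_measure I)" using True by measurable
  from integrable_field_measure[OF I this] True show ?thesis
    by (simp add: square_integrable_def norm_weighted_square)
qed (simp add: square_integrable_def)

lemma L2_norm_field:
  assumes I: "I \<in> sets lebesgue" and f: "f \<in> borel_measurable (field_measure I)"
  shows "(L2_norm (field_measure I) f)\<^sup>2 = (\<integral>z. (cmod (weighted I f z))\<^sup>2 \<partial>lebesgue)"
proof -
  have "(\<lambda>x. (cmod (f x))\<^sup>2) \<in> borel_measurable (field_measure I)" using f by measurable
  from integral_field_measure[OF I this] show ?thesis
    by (simp add: L2_norm_def norm_weighted_square integral_nonneg_AE)
qed

lemma L2_inner_field:
  assumes I: "I \<in> sets lebesgue"
    and f: "f \<in> borel_measurable (field_measure I)" and g: "g \<in> borel_measurable (field_measure I)"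
  shows "L2_inner (field_measure I) f g = (\<integral>z. weighted I f z * cnj (weighted I g z) \<partial>lebesgue)"
proof -
  have "(\<lambda>x. f x * cnj (g x)) \<in> borel_measurable (field_measure I)" using f g by measurable
  moreover have "(indicator I (fst z) * \<bar>fst z\<bar>) *\<^sub>R (f z * cnj (g z)) = weighted I f z * cnj (weighted I g z)" for z
    by (auto simp: weighted_def indicator_def scaleR_conv_of_real simp flip: of_real_mult)
  ultimately show ?thesis
    unfolding L2_inner_def by (simp add: integral_field_measure[OF I])
qed

lemma weighted_T_hat:
  "weighted I (T_hat k l m g) (\<xi>, t)
    = fourier_char m \<xi> * (cis (- (2 * pi * \<xi> * of_int l * t)) * weighted I g (\<xi>, t - of_int k))"
  by (simp add: weighted_def T_hat_def fourier_char_def)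

lemma T_hat_measurable:
  assumes I: "I \<in> sets lebesgue" and g: "g \<in> borel_measurable (field_measure I)"
  shows "T_hat k l m g \<in> borel_measurable (field_measure I)"
proof -
  let ?G = "\<lambda>z. indicator (I \<times> UNIV) z *\<^sub>R g z"
  have "(\<lambda>z. ?G (z - (0, of_int k))) \<in> borel_measurable lebesgue"
    using g measurable_compose[OF lebesgue_shift_measurable, of ?G] by (simp add: field_measurable_iff[OF I])
  moreover have "(\<lambda>z. cis (2 * pi * fst z * of_int m) * cis (- (2 * pi * fst z * of_int l * snd z))) \<in> borel_measurable lebesgue"
    by (intro borel_measurable_lebesgueI) measurable
  ultimately have "(\<lambda>z. cis (2 * pi * fst z * of_int m) * cis (- (2 * pi * fst z * of_int l * snd z)) *
     ?G (z - (0, of_int k))) \<in> borel_measurable lebesgue" by (rule borel_measurable_times[rotated])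
  also have "(\<lambda>z. cis (2 * pi * fst z * of_int m) * cis (- (2 * pi * fst z * of_int l * snd z)) *
     ?G (z - (0, of_int k))) = (\<lambda>z. indicator (I \<times> UNIV) z *\<^sub>R T_hat k l m g z)"
    by (auto simp: fun_eq_iff T_hat_def indicator_def)
  finally show ?thesis by (simp add: field_measurable_iff[OF I])
qed

text \<open>The modulus of \<open>T_hat k l m g\<close> is that of \<open>g\<close> translated in \<open>t\<close>, and the weight depends on \<open>\<xi>\<close> only.\<close>

lemma T_hat_square_integrable:
  assumes I: "I \<in> sets lebesgue" and g: "square_integrable (field_measure I) g"
  shows "square_integrable (field_measure I) (T_hat k l m g)"
proof -
  have gm: "g \<in> borel_measurable (field_measure I)" using g by (simp add: square_integrable_def)
  obtain g' where g' [measurable]: "g' \<in> borel_measurable borel" "AE z in lborel. weighted I g z = g' z"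
    using lebesgue_borel_version[OF weighted_measurable[OF I gm]] by blast
  have Tm: "T_hat k l m g \<in> borel_measurable (field_measure I)" by (rule T_hat_measurable[OF I gm])
  have "AE z in lborel. (cmod (weighted I g z))\<^sup>2 = (cmod (g' z))\<^sup>2"
    using g'(2) by eventually_elim simp
  moreover have "(\<lambda>z. (cmod (weighted I g z))\<^sup>2) \<in> borel_measurable lebesgue"
    using weighted_measurable[OF I gm] by measurable
  ultimately have "integrable lborel (\<lambda>z. (cmod (g' z))\<^sup>2)"
    using g by (subst integrable_lebesgue_lborel_cong(1)[symmetric, of "\<lambda>z. (cmod (weighted I g z))\<^sup>2"])
      (auto simp: square_integrable_field_iff[OF I])
  hence "integrable lborel (\<lambda>z. (cmod (g' (z - (0, of_int k))))\<^sup>2)" by (rule lborel_integrable_shift)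
  moreover have "AE z in lborel. (cmod (weighted I (T_hat k l m g) z))\<^sup>2 = (cmod (g' (z - (0, of_int k))))\<^sup>2"
    using lborel_AE_shift[OF g'(2), of "(0, of_int k)"]
    by eventually_elim (auto simp: weighted_T_hat norm_mult)
  ultimately have "integrable lebesgue (\<lambda>z. (cmod (weighted I (T_hat k l m g) z))\<^sup>2)"
    using weighted_measurable[OF I Tm]
    by (subst integrable_lebesgue_lborel_cong(1)[of _ "\<lambda>z. (cmod (g' (z - (0, of_int k))))\<^sup>2"]) auto
  thus ?thesis using Tm by (simp add: square_integrable_field_iff[OF I])
qed

text \<open>The inner product of the fibre of \<open>f\<close> over \<open>\<xi>\<close> with an element of the Gabor system generated by the
  fibre of \<open>g\<close>; both functions already contain the weight.\<close>

definition fiber_coeff :: "(real \<times> real \<Rightarrow> complex) \<Rightarrow> (real \<times> real \<Rightarrow> complex) \<Rightarrow> int \<Rightarrow> int \<Rightarrow> real \<Rightarrow> complex" where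
  "fiber_coeff f g k l \<xi> =
     (\<integral>t. f (\<xi>, t) * cnj (cis (- (2 * pi * \<xi> * of_int l * t)) * g (\<xi>, t - of_int k)) \<partial>lborel)"

lemma fiber_coeff_measurable [measurable]:
  assumes [measurable]: "f \<in> borel_measurable borel" "g \<in> borel_measurable borel"
  shows "fiber_coeff f g k l \<in> borel_measurable borel"
proof -
  have "(\<lambda>z. f z * cnj (cis (- (2 * pi * fst z * of_int l * snd z)) * g (z - (0, of_int k))))
      \<in> borel_measurable borel" by measurable
  hence "(\<lambda>(\<xi>, t). f (\<xi>, t) * cnj (cis (- (2 * pi * \<xi> * of_int l * t)) * g (\<xi>, t - of_int k)))
      \<in> borel_measurable (lborel \<Otimes>\<^sub>M lborel)"
    by (simp add: lborel_prod case_prod_unfold minus_prod_def)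
  hence "(\<lambda>(\<xi>, t). f (\<xi>, t) * cnj (cis (- (2 * pi * \<xi> * of_int l * t)) * g (\<xi>, t - of_int k)))
      \<in> borel_measurable (borel \<Otimes>\<^sub>M lborel)"
    by (subst measurable_cong_sets[of _ "lborel \<Otimes>\<^sub>M lborel"]) (auto intro!: sets_pair_measure_cong)
  thus ?thesis unfolding fiber_coeff_def[abs_def]
    by (rule lborel.borel_measurable_lebesgue_integral)
qed

text \<open>Integrating over \<open>t\<close> first isolates the factor of \<open>T_hat\<close> with index \<open>m\<close>, which depends on \<open>\<xi>\<close> only: the
  inner products for fixed \<open>k\<close> and \<open>l\<close> are the Fourier coefficients of a single function on \<open>I\<close>.\<close>

lemma L2_inner_T_hat:
  assumes I: "I \<in> sets lebesgue"
    and f: "square_integrable (field_measure I) f" and g: "square_integrable (field_measure I) g"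
    and f' [measurable]: "f' \<in> borel_measurable borel" and ff': "AE z in lborel. weighted I f z = f' z"
    and g' [measurable]: "g' \<in> borel_measurable borel" and gg': "AE z in lborel. weighted I g z = g' z"
  shows "L2_inner (field_measure I) f (T_hat k l m g)
    = (\<integral>\<xi>. fiber_coeff f' g' k l \<xi> * cnj (fourier_char m \<xi>) \<partial>lborel)"
proof -
  have fm: "f \<in> borel_measurable (field_measure I)" using f by (simp add: square_integrable_def)
  have T: "square_integrable (field_measure I) (T_hat k l m g)" by (rule T_hat_square_integrable[OF I g])
  have Tm: "T_hat k l m g \<in> borel_measurable (field_measure I)" using T by (simp add: square_integrable_def)
  let ?H = "\<lambda>z. f' z * cnj (fourier_char m (fst z) *
     (cis (- (2 * pi * fst z * of_int l * snd z)) * g' (z - (0, of_int k))))"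
  have wm: "(\<lambda>z. weighted I f z * cnj (weighted I (T_hat k l m g) z)) \<in> borel_measurable lebesgue"
    using weighted_measurable[OF I fm] weighted_measurable[OF I Tm] by measurable
  have H: "?H \<in> borel_measurable borel" by measurable
  have ae: "AE z in lborel. weighted I f z * cnj (weighted I (T_hat k l m g) z) = ?H z"
    using ff' lborel_AE_shift[OF gg', of "(0, of_int k)"]
    by eventually_elim (auto simp: weighted_T_hat)
  have "square_integrable lebesgue (weighted I f)" "square_integrable lebesgue (weighted I (T_hat k l m g))"
    using f T weighted_measurable[OF I fm] weighted_measurable[OF I Tm]
    by (auto simp: square_integrable_field_iff[OF I] square_integrable_def[of lebesgue])
  hence "integrable lebesgue (\<lambda>z. weighted I f z * cnj (weighted I (T_hat k l m g) z))"
    by (intro square_integrable_mult_integrable square_integrable_cnj)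
  hence Hint: "integrable (lborel \<Otimes>\<^sub>M lborel) ?H"
    using integrable_lebesgue_lborel_cong(1)[OF wm H ae] by (simp add: lborel_prod)
  have "L2_inner (field_measure I) f (T_hat k l m g) = integral\<^sup>L lborel ?H"
    using integrable_lebesgue_lborel_cong(2)[OF wm H ae] by (simp add: L2_inner_field[OF I fm Tm])
  also have "\<dots> = (\<integral>\<xi>. \<integral>t. ?H (\<xi>, t) \<partial>lborel \<partial>lborel)"
    using lborel_pair.integral_fst'[OF Hint] by (simp add: lborel_prod)
  also have "\<dots> = (\<integral>\<xi>. fiber_coeff f' g' k l \<xi> * cnj (fourier_char m \<xi>) \<partial>lborel)"
  proof (rule Bochner_Integration.integral_cong[OF refl])
    fix \<xi>
    have "(\<integral>t. ?H (\<xi>, t) \<partial>lborel) = (\<integral>t. cnj (fourier_char m \<xi>) *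
      (f' (\<xi>, t) * cnj (cis (- (2 * pi * \<xi> * of_int l * t)) * g' (\<xi>, t - of_int k))) \<partial>lborel)"
      by (simp add: mult_ac)
    thus "(\<integral>t. ?H (\<xi>, t) \<partial>lborel) = fiber_coeff f' g' k l \<xi> * cnj (fourier_char m \<xi>)"
      by (simp only: fiber_coeff_def integral_mult_right_zero mult.commute)
  qed
  finally show ?thesis .
qed

section \<open>Disjoint translates give a frame set\<close>

text \<open>The Parseval property of the Gabor system over one point \<open>\<xi>\<close>, rewritten for Borel versions of \<open>f\<close> and
  of \<open>g\<close> and as an identity of nonnegative integrals.\<close>

lemma fiber_parseval:
  assumes xi: "\<xi> \<in> I"
    and P: "parseval_frame_L2 lebesgue UNIV
          (\<lambda>(k :: int, l :: int) t.
             complex_of_real (sqrt \<bar>\<xi>\<bar>) * cis (- (2 * pi * \<xi> * of_int l * t)) *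
             g (\<xi>, t - of_int k))" (is "parseval_frame_L2 _ _ ?\<psi>")
    and gg': "AE t in lborel. weighted I g (\<xi>, t) = g' (\<xi>, t)"
    and f' [measurable]: "f' \<in> borel_measurable borel" and g' [measurable]: "g' \<in> borel_measurable borel"
    and f2: "integrable lborel (\<lambda>t. (cmod (f' (\<xi>, t)))\<^sup>2)"
  shows "(\<integral>\<^sup>+j. ennreal ((cmod (fiber_coeff f' g' (fst j) (snd j) \<xi>))\<^sup>2) \<partial>count_space UNIV)
    = (\<integral>\<^sup>+t. ennreal ((cmod (f' (\<xi>, t)))\<^sup>2) \<partial>lborel)"
proof -
  define u where "u t = f' (\<xi>, t)" for t
  have u [measurable]: "u \<in> borel_measurable borel" unfolding u_def[abs_def] by measurable
  have u2: "square_integrable lebesgue u"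
    using f2 by (auto simp: square_integrable_def integrable_completion u_def[abs_def] intro!: borel_measurable_lebesgueI)
  have coeff: "L2_inner lebesgue u (?\<psi> j) = fiber_coeff f' g' (fst j) (snd j) \<xi>" for j
  proof -
    obtain k l where j: "j = (k, l)" by (cases j)
    have psi: "?\<psi> (k, l) \<in> borel_measurable lebesgue"
      using bspec[OF conjunct1[OF P[unfolded parseval_frame_L2_def]], of "(k, l)"]
      unfolding square_integrable_def by simp
    have "L2_inner lebesgue u (?\<psi> (k, l))
      = (\<integral>t. u t * cnj (cis (- (2 * pi * \<xi> * of_int l * t)) * g' (\<xi>, t - of_int k)) \<partial>lborel)"
      unfolding L2_inner_def
    proof (rule integrable_lebesgue_lborel_cong(2))
      show "(\<lambda>t. u t * cnj (?\<psi> (k, l) t)) \<in> borel_measurable lebesgue"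
        using psi borel_measurable_lebesgueI[OF u] by measurable
      show "AE t in lborel. u t * cnj (?\<psi> (k, l) t)
          = u t * cnj (cis (- (2 * pi * \<xi> * of_int l * t)) * g' (\<xi>, t - of_int k))"
        using lborel_AE_shift[OF gg', of "of_int k"]
      proof eventually_elim
        case (elim t)
        have "complex_of_real (sqrt \<bar>\<xi>\<bar>) * g (\<xi>, t - of_int k) = g' (\<xi>, t - of_int k)"
          using elim xi by (simp add: weighted_def scaleR_conv_of_real)
        moreover have "?\<psi> (k, l) t = cis (- (2 * pi * \<xi> * of_int l * t)) *
            (complex_of_real (sqrt \<bar>\<xi>\<bar>) * g (\<xi>, t - of_int k))"
          by simp
        ultimately have "?\<psi> (k, l) t = cis (- (2 * pi * \<xi> * of_int l * t)) * g' (\<xi>, t - of_int k)"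
          by (simp only:)
        thus ?case by (simp only:)
      qed
    qed measurable
    thus ?thesis by (simp add: j fiber_coeff_def u_def)
  qed
  have n2: "(L2_norm lebesgue u)\<^sup>2 = (\<integral>t. (cmod (f' (\<xi>, t)))\<^sup>2 \<partial>lborel)"
  proof -
    have "(\<lambda>t. (cmod (u t))\<^sup>2) \<in> borel_measurable lborel" by measurable
    from integral_completion[OF this] show ?thesis by (simp add: L2_norm_def u_def)
  qed
  have "((\<lambda>j. (cmod (L2_inner lebesgue u (?\<psi> j)))\<^sup>2) has_sum (L2_norm lebesgue u)\<^sup>2) UNIV"
    using P u2 unfolding parseval_frame_L2_def by blast
  hence "(\<integral>\<^sup>+j. ennreal ((cmod (fiber_coeff f' g' (fst j) (snd j) \<xi>))\<^sup>2) \<partial>count_space UNIV)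
      = ennreal ((L2_norm lebesgue u)\<^sup>2)"
    unfolding coeff by (subst (asm) has_sum_iff_nn_integral) auto
  also have "\<dots> = (\<integral>\<^sup>+t. ennreal ((cmod (f' (\<xi>, t)))\<^sup>2) \<partial>lborel)"
    unfolding n2 by (rule nn_integral_eq_integral[symmetric, OF f2]) simp
  finally show ?thesis .
qed

lemma AE_gabor_field:
  assumes I: "I \<in> sets lebesgue" and g: "gabor_field I g"
  shows "AE \<xi> in lborel. \<xi> \<in> I \<longrightarrow> parseval_frame_L2 lebesgue UNIV
          (\<lambda>(k :: int, l :: int) t.
             complex_of_real (sqrt \<bar>\<xi>\<bar>) * cis (- (2 * pi * \<xi> * of_int l * t)) *
             g (\<xi>, t - of_int k))"
proof -
  have "AE \<xi> in lebesgue. \<xi> \<in> I \<longrightarrow> parseval_frame_L2 lebesgue UNIV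
          (\<lambda>(k :: int, l :: int) t.
             complex_of_real (sqrt \<bar>\<xi>\<bar>) * cis (- (2 * pi * \<xi> * of_int l * t)) *
             g (\<xi>, t - of_int k))"
    using g I unfolding gabor_field_def by (subst (asm) AE_restrict_space_iff) auto
  thus ?thesis by (simp only: AE_completion_iff)
qed

text \<open>The sum over \<open>m\<close> is evaluated by the Parseval identity for Fourier series on \<open>I\<close>, the sum over \<open>k\<close> and
  \<open>l\<close> by the Parseval property of the fibres, with Tonelli's theorem in between.\<close>

theorem disjoint_translates_imp_GH_frame_set:
  assumes I: "I \<in> sets lebesgue" and sub: "I \<subseteq> {-1..1}"
    and null: "{x \<in> I. x + 1 \<in> I} \<in> null_sets lebesgue"
  shows "GH_frame_set I"
  unfolding GH_frame_set_def
proof (intro conjI I sub allI impI)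
  fix g assume gab: "gabor_field I g"
  hence g: "square_integrable (field_measure I) g" by (simp add: gabor_field_def)
  show "parseval_frame_L2 (field_measure I) UNIV (\<lambda>(k, l, m). T_hat k l m g)"
    unfolding parseval_frame_L2_def
  proof (intro conjI ballI allI impI)
    fix j show "square_integrable (field_measure I) (case j of (k, l, m) \<Rightarrow> T_hat k l m g)"
      by (cases j) (simp add: T_hat_square_integrable[OF I g])
  next
    fix f assume f: "square_integrable (field_measure I) f"
    have fm: "f \<in> borel_measurable (field_measure I)" and gm: "g \<in> borel_measurable (field_measure I)"
      using f g by (auto simp: square_integrable_def)
    obtain f' where f' [measurable]: "f' \<in> borel_measurable borel" and ff': "AE z in lborel. weighted I f z = f' z"
      using lebesgue_borel_version[OF weighted_measurable[OF I fm]] by blast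
    obtain g' where g' [measurable]: "g' \<in> borel_measurable borel" and gg': "AE z in lborel. weighted I g z = g' z"
      using lebesgue_borel_version[OF weighted_measurable[OF I gm]] by blast
    let ?F = "\<lambda>j. fiber_coeff f' g' (fst j) (snd j)"
    have "AE z in lborel. (cmod (weighted I f z))\<^sup>2 = (cmod (f' z))\<^sup>2"
      using ff' by eventually_elim simp
    note * = integrable_lebesgue_lborel_cong[OF _ _ this]
    have wm: "(\<lambda>z. (cmod (weighted I f z))\<^sup>2) \<in> borel_measurable lebesgue"
      "(\<lambda>z. (cmod (f' z))\<^sup>2) \<in> borel_measurable borel"
      using weighted_measurable[OF I fm] by measurable
    have f2: "integrable lborel (\<lambda>z. (cmod (f' z))\<^sup>2)"
      using *(1)[OF wm] f by (simp add: square_integrable_field_iff[OF I])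
    have norm_f: "(L2_norm (field_measure I) f)\<^sup>2 = (\<integral>z. (cmod (f' z))\<^sup>2 \<partial>lborel)"
      using *(2)[OF wm] by (simp add: L2_norm_field[OF I fm])
    have tonelli: "(\<integral>\<^sup>+\<xi>. \<integral>\<^sup>+t. ennreal ((cmod (f' (\<xi>, t)))\<^sup>2) \<partial>lborel \<partial>lborel)
      = ennreal ((L2_norm (field_measure I) f)\<^sup>2)"
    proof -
      have "(\<integral>\<^sup>+\<xi>. \<integral>\<^sup>+t. ennreal ((cmod (f' (\<xi>, t)))\<^sup>2) \<partial>lborel \<partial>lborel)
        = (\<integral>\<^sup>+z. ennreal ((cmod (f' z))\<^sup>2) \<partial>(lborel \<Otimes>\<^sub>M lborel))"
        by (rule lborel.nn_integral_fst) (simp add: lborel_prod)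
      also have "\<dots> = ennreal ((L2_norm (field_measure I) f)\<^sup>2)"
        unfolding lborel_prod norm_f by (rule nn_integral_eq_integral[OF f2]) simp
      finally show ?thesis .
    qed
    have f2_ae: "AE \<xi> in lborel. integrable lborel (\<lambda>t. (cmod (f' (\<xi>, t)))\<^sup>2)"
    proof -
      have "integrable (lborel \<Otimes>\<^sub>M lborel) (\<lambda>z. (cmod (f' z))\<^sup>2)" using f2 by (simp only: lborel_prod)
      from lborel_pair.AE_integrable_fst'[OF this] show ?thesis .
    qed
    \<comment> \<open>A Borel version of a function supported over \<open>I\<close> can be nonzero elsewhere, but only on a null set.\<close>
    have off: "AE \<xi> in lborel. \<xi> \<notin> I \<longrightarrow> (AE t in lborel. f' (\<xi>, t) = 0)"
      using AE_lborel_pair[OF ff'] by eventually_elim (auto simp: weighted_def elim!: eventually_mono)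
    have F0: "AE \<xi> in lborel. \<xi> \<notin> I \<longrightarrow> (\<forall>j. ?F j \<xi> = 0)"
      using off
    proof (eventually_elim, intro impI allI)
      fix \<xi> and j :: "int \<times> int"
      assume "\<xi> \<notin> I \<longrightarrow> (AE t in lborel. f' (\<xi>, t) = 0)" "\<xi> \<notin> I"
      thus "?F j \<xi> = 0"
        unfolding fiber_coeff_def by (intro integral_eq_zero_AE) (auto elim!: eventually_mono)
    qed
    have fiber: "AE \<xi> in lborel. (\<integral>\<^sup>+j. ennreal ((cmod (?F j \<xi>))\<^sup>2) \<partial>count_space UNIV)
        = (\<integral>\<^sup>+t. ennreal ((cmod (f' (\<xi>, t)))\<^sup>2) \<partial>lborel)"
      using F0 off f2_ae AE_lborel_pair[OF gg'] AE_gabor_field[OF I gab]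
    proof eventually_elim
      case (elim \<xi>)
      show ?case
      proof (cases "\<xi> \<in> I")
        case True
        show ?thesis by (rule fiber_parseval[OF True mp[OF elim(5) True] elim(4) f' g' elim(3)])
      next
        case False
        have "(\<integral>\<^sup>+t. ennreal ((cmod (f' (\<xi>, t)))\<^sup>2) \<partial>lborel) = (\<integral>\<^sup>+t. 0 \<partial>(lborel :: real measure))"
          by (rule nn_integral_cong_AE) (use elim False in \<open>auto elim!: eventually_mono\<close>)
        thus ?thesis using elim False by simp
      qed
    qed
    have F2: "square_integrable lborel (?F j)" for j
    proof -
      have "(\<integral>\<^sup>+\<xi>. ennreal ((cmod (?F j \<xi>))\<^sup>2) \<partial>lborel)
          \<le> (\<integral>\<^sup>+\<xi>. \<integral>\<^sup>+t. ennreal ((cmod (f' (\<xi>, t)))\<^sup>2) \<partial>lborel \<partial>lborel)"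
      proof (rule nn_integral_mono_AE, use fiber in eventually_elim)
        fix \<xi>
        assume *: "(\<integral>\<^sup>+j. ennreal ((cmod (?F j \<xi>))\<^sup>2) \<partial>count_space UNIV)
            = (\<integral>\<^sup>+t. ennreal ((cmod (f' (\<xi>, t)))\<^sup>2) \<partial>lborel)"
        show "ennreal ((cmod (?F j \<xi>))\<^sup>2) \<le> (\<integral>\<^sup>+t. ennreal ((cmod (f' (\<xi>, t)))\<^sup>2) \<partial>lborel)"
          unfolding *[symmetric] by (rule nn_integral_ge_point) simp
      qed
      hence "(\<integral>\<^sup>+\<xi>. ennreal ((cmod (?F j \<xi>))\<^sup>2) \<partial>lborel) < \<infinity>"
        unfolding tonelli by (rule le_less_trans) simp
      thus ?thesis by (auto simp: square_integrable_def intro!: integrableI_nonneg)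
    qed
    have disj: "AE \<xi> in lborel. ?F j \<xi> = 0 \<or> ?F j (\<xi> + 1) = 0" for j
    proof -
      have "AE \<xi> in lborel. \<xi> - (-1) \<notin> I \<longrightarrow> (\<forall>j. ?F j (\<xi> - (-1)) = 0)"
        by (rule lborel_AE_shift[OF F0])
      moreover have "AE \<xi> in lebesgue. \<xi> \<notin> {x \<in> I. x + 1 \<in> I}" by (rule AE_not_in[OF null])
      hence "AE \<xi> in lborel. \<xi> \<notin> {x \<in> I. x + 1 \<in> I}" by (simp only: AE_completion_iff)
      ultimately show ?thesis using F0 by eventually_elim auto
    qed
    have supp: "AE \<xi> in lborel. ?F j \<xi> \<noteq> 0 \<longrightarrow> \<xi> \<in> {-1..1}" for j
      using F0 by eventually_elim (use sub in auto)
    let ?c = "\<lambda>j. (cmod (L2_inner (field_measure I) f (case j of (k, l, m) \<Rightarrow> T_hat k l m g)))\<^sup>2"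
    have sum_m: "(\<integral>\<^sup>+m. ennreal (?c (k, l, m)) \<partial>count_space UNIV)
        = (\<integral>\<^sup>+\<xi>. ennreal ((cmod (?F (k, l) \<xi>))\<^sup>2) \<partial>lborel)" for k l
      using fourier_parseval_disjoint_translates[OF F2 supp disj, of "(k, l)"]
      by (simp add: L2_inner_T_hat[OF I f g f' ff' g' gg'])
    have "(\<integral>\<^sup>+j. ennreal (?c j) \<partial>count_space UNIV)
      = (\<integral>\<^sup>+k. \<integral>\<^sup>+lm. ennreal (?c (k, lm)) \<partial>count_space UNIV \<partial>count_space UNIV)"
      by (rule nn_integral_fst_count_space[symmetric])
    also have "\<dots> = (\<integral>\<^sup>+k. \<integral>\<^sup>+l. \<integral>\<^sup>+m. ennreal (?c (k, l, m)) \<partial>count_space UNIV \<partial>count_space UNIV \<partial>count_space UNIV)"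
      by (intro nn_integral_cong nn_integral_fst_count_space[symmetric])
    also have "\<dots> = (\<integral>\<^sup>+k. \<integral>\<^sup>+l. \<integral>\<^sup>+\<xi>. ennreal ((cmod (?F (k, l) \<xi>))\<^sup>2) \<partial>lborel \<partial>count_space UNIV \<partial>count_space UNIV)"
      unfolding sum_m ..
    also have "\<dots> = (\<integral>\<^sup>+j. \<integral>\<^sup>+\<xi>. ennreal ((cmod (?F j \<xi>))\<^sup>2) \<partial>lborel \<partial>count_space UNIV)"
      by (rule nn_integral_fst_count_space)
    also have "\<dots> = (\<integral>\<^sup>+\<xi>. \<integral>\<^sup>+j. ennreal ((cmod (?F j \<xi>))\<^sup>2) \<partial>count_space UNIV \<partial>lborel)"
      by (rule nn_integral_count_space_nn_integral[symmetric]) auto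
    also have "\<dots> = (\<integral>\<^sup>+\<xi>. \<integral>\<^sup>+t. ennreal ((cmod (f' (\<xi>, t)))\<^sup>2) \<partial>lborel \<partial>lborel)"
      by (rule nn_integral_cong_AE[OF fiber])
    also have "\<dots> = ennreal ((L2_norm (field_measure I) f)\<^sup>2)" by (rule tonelli)
    finally show "(?c has_sum (L2_norm (field_measure I) f)\<^sup>2) UNIV"
      by (subst has_sum_iff_nn_integral) auto
  qed
qed

section \<open>A Gabor field of signed windows\<close>

text \<open>The fibre over \<open>\<xi> \<noteq> 0\<close> is the indicator function of \<open>[0,1)\<close> if \<open>\<xi> > 0\<close> and of \<open>(-1,0]\<close> if \<open>\<xi> < 0\<close>. The
  condition is written in the variable \<open>\<xi> * t\<close>, in which the window is \<open>[0, |\<xi>|)\<close> for both signs.\<close>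

definition signed_window :: "real \<times> real \<Rightarrow> complex" where
  "signed_window = (\<lambda>(\<xi>, t). of_bool (0 \<le> \<xi> * t \<and> \<xi> * t < \<bar>\<xi>\<bar>))"

lemma signed_window_borel [measurable]: "signed_window \<in> borel_measurable borel"
proof -
  have eq: "signed_window = indicator {z. 0 \<le> fst z * snd z \<and> fst z * snd z < \<bar>fst z\<bar>}"
    by (auto simp: signed_window_def indicator_def)
  have "{z \<in> space borel. 0 \<le> fst z * snd z \<and> fst z * snd z < \<bar>fst z\<bar>} \<in> sets (borel :: (real \<times> real) measure)"
    by measurable
  hence "{z. 0 \<le> fst z * snd z \<and> fst z * snd z < \<bar>fst z\<bar>} \<in> sets (borel :: (real \<times> real) measure)"
    by simp
  thus ?thesis unfolding eq by (rule borel_measurable_indicator)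
qed

lemma signed_window_tiles:
  assumes "\<xi> \<noteq> 0"
  obtains n :: int where "\<And>k. signed_window (\<xi>, t - of_int k) = of_bool (k = n)"
proof (cases "\<xi> > 0")
  case True
  have "0 \<le> \<xi> * s \<and> \<xi> * s < \<bar>\<xi>\<bar> \<longleftrightarrow> 0 \<le> s \<and> s < 1" for s
    using True mult_less_cancel_left_pos[of \<xi> s 1] by (simp add: zero_le_mult_iff)
  moreover have "0 \<le> t - of_int k \<and> t - of_int k < 1 \<longleftrightarrow> k = \<lfloor>t\<rfloor>" for k
    using floor_eq_iff[of t k] by linarith
  ultimately show ?thesis by (intro that[of "\<lfloor>t\<rfloor>"]) (simp only: signed_window_def prod.case)
next
  case False
  hence "\<xi> < 0" using assms by simp
  hence "0 \<le> \<xi> * s \<and> \<xi> * s < \<bar>\<xi>\<bar> \<longleftrightarrow> s \<le> 0 \<and> -1 < s" for s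
    using mult_less_cancel_left_neg[of \<xi> s "-1"] by (simp add: zero_le_mult_iff)
  moreover have "t - of_int k \<le> 0 \<and> -1 < t - of_int k \<longleftrightarrow> k = \<lceil>t\<rceil>" for k
    using ceiling_eq_iff[of t k] by linarith
  ultimately show ?thesis by (intro that[of "\<lceil>t\<rceil>"]) (simp only: signed_window_def prod.case)
qed

text \<open>The translates of the window tile the line, so that only functions on one tile need to be expanded.
  Substituting \<open>t = k + x / \<xi>\<close> turns the modulations into the characters of period \<open>1\<close> and the tile
  into \<open>[0, |\<xi>|)\<close>, an interval of length at most \<open>1\<close>, where the Parseval identity for Fourier series
  applies.\<close>

lemma signed_window_parseval:
  assumes xi: "\<xi> \<noteq> 0" "\<bar>\<xi>\<bar> \<le> 1"
  shows "parseval_frame_L2 lebesgue UNIV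
          (\<lambda>(k :: int, l :: int) t.
             complex_of_real (sqrt \<bar>\<xi>\<bar>) * cis (- (2 * pi * \<xi> * of_int l * t)) *
             signed_window (\<xi>, t - of_int k))"
    (is "parseval_frame_L2 _ _ ?\<psi>")
  unfolding parseval_frame_L2_def
proof (intro conjI ballI allI impI)
  fix j :: "int \<times> int"
  obtain k l where j: "j = (k, l)" by (cases j)
  have psi_borel: "?\<psi> j \<in> borel_measurable borel"
    unfolding j by (simp, measurable)
  have "integrable lborel (\<lambda>t. (cmod (?\<psi> j t))\<^sup>2)"
  proof (rule Bochner_Integration.integrable_bound)
    show "integrable lborel (\<lambda>t::real. indicator {of_int k - 1..of_int k + 1} t :: real)"
      by (intro integrable_real_indicator) auto
    show "AE t in lborel. norm ((cmod (?\<psi> j t))\<^sup>2) \<le> norm (indicator {of_int k - 1..of_int k + 1} t :: real)"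
    proof (rule AE_I2)
      fix t
      have "\<bar>t - of_int k\<bar> \<le> 1" if "\<xi> * (t - of_int k) < \<bar>\<xi>\<bar>" "0 \<le> \<xi> * (t - of_int k)"
      proof -
        have "\<bar>\<xi>\<bar> * \<bar>t - of_int k\<bar> < \<bar>\<xi>\<bar> * 1" using that by (simp add: abs_mult[symmetric])
        thus ?thesis using mult_left_less_imp_less[of "\<bar>\<xi>\<bar>"] by fastforce
      qed
      thus "norm ((cmod (?\<psi> j t))\<^sup>2) \<le> norm (indicator {of_int k - 1..of_int k + 1} t :: real)"
        using xi by (auto simp: j signed_window_def norm_mult indicator_def)
    qed
  qed (use psi_borel in measurable)
  thus "square_integrable lebesgue (?\<psi> j)"
    using psi_borel by (auto simp: square_integrable_def integrable_completion intro!: measurable_completion)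
next
  fix u :: "real \<Rightarrow> complex"
  assume u: "square_integrable lebesgue u"
  then obtain v where v [measurable]: "v \<in> borel_measurable borel" and uv: "AE t in lborel. u t = v t"
    using lebesgue_borel_version by (auto simp: square_integrable_def)
  have um [measurable]: "u \<in> borel_measurable lebesgue" using u by (simp add: square_integrable_def)
  have "AE t in lborel. (cmod (u t))\<^sup>2 = (cmod (v t))\<^sup>2" using uv by eventually_elim simp
  note * = integrable_lebesgue_lborel_cong[OF _ _ this]
  have v2: "integrable lborel (\<lambda>t. (cmod (v t))\<^sup>2)"
    and norm_u: "(L2_norm lebesgue u)\<^sup>2 = (\<integral>t. (cmod (v t))\<^sup>2 \<partial>lborel)"
    using * u by (auto simp: square_integrable_def L2_norm_def)
  define F where "F k x = v (of_int k + x / \<xi>) * indicator {0..<\<bar>\<xi>\<bar>} x" for k :: int and x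
  have [measurable]: "F k \<in> borel_measurable borel" for k unfolding F_def[abs_def] by measurable
  \<comment> \<open>The tile with number \<open>k\<close> corresponds to \<open>[0, |\<xi>|)\<close> in the new variable.\<close>
  have box: "signed_window (\<xi>, (of_int k + x / \<xi>) - of_int k) = indicator {0..<\<bar>\<xi>\<bar>} x" for k :: int and x
    using xi by (simp add: signed_window_def indicator_def)
  have coeff: "\<bar>\<xi>\<bar> * (cmod (L2_inner lebesgue u (?\<psi> (k, l))))\<^sup>2
      = (cmod (\<integral>x. F k x * cnj (fourier_char (- l) x) \<partial>lborel))\<^sup>2" for k l
  proof -
    have "L2_inner lebesgue u (?\<psi> (k, l)) = (\<integral>t. v t * cnj (?\<psi> (k, l) t) \<partial>lborel)"
      unfolding L2_inner_def
    proof (rule integrable_lebesgue_lborel_cong(2))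
      show "(\<lambda>t. v t * cnj (?\<psi> (k, l) t)) \<in> borel_measurable borel" by simp
      have "?\<psi> (k, l) \<in> borel_measurable lebesgue"
        by (intro measurable_completion) (simp, measurable)
      thus "(\<lambda>t. u t * cnj (?\<psi> (k, l) t)) \<in> borel_measurable lebesgue" by measurable
      show "AE t in lborel. u t * cnj (?\<psi> (k, l) t) = v t * cnj (?\<psi> (k, l) t)"
        using uv by eventually_elim simp
    qed
    also have "\<dots> = \<bar>1 / \<xi>\<bar> *\<^sub>R (\<integral>x. v (of_int k + 1 / \<xi> * x) * cnj (?\<psi> (k, l) (of_int k + 1 / \<xi> * x)) \<partial>lborel)"
      by (rule lborel_integral_real_affine) (use xi in simp)
    also have "(\<lambda>x. v (of_int k + 1 / \<xi> * x) * cnj (?\<psi> (k, l) (of_int k + 1 / \<xi> * x)))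
      = (\<lambda>x. (of_real (sqrt \<bar>\<xi>\<bar>) * cis (2 * pi * \<xi> * of_int l * of_int k)) * (F k x * cnj (fourier_char (- l) x)))"
    proof
      fix x
      have "cis (2 * pi * \<xi> * of_int l * (of_int k + x / \<xi>))
        = cis (2 * pi * \<xi> * of_int l * of_int k) * cis (2 * pi * x * of_int l)"
        unfolding cis_mult by (rule arg_cong[of _ _ cis]) (use xi in \<open>simp add: field_simps\<close>)
      thus "v (of_int k + 1 / \<xi> * x) * cnj (?\<psi> (k, l) (of_int k + 1 / \<xi> * x)) =
        (of_real (sqrt \<bar>\<xi>\<bar>) * cis (2 * pi * \<xi> * of_int l * of_int k)) * (F k x * cnj (fourier_char (- l) x))"
        using box[of k x] by (simp add: F_def fourier_char_def cis_cnj indicator_def)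
    qed
    finally have "L2_inner lebesgue u (?\<psi> (k, l)) = \<bar>1 / \<xi>\<bar> *\<^sub>R
      ((of_real (sqrt \<bar>\<xi>\<bar>) * cis (2 * pi * \<xi> * of_int l * of_int k)) *
       (\<integral>x. F k x * cnj (fourier_char (- l) x) \<partial>lborel))" by simp
    hence "cmod (L2_inner lebesgue u (?\<psi> (k, l))) = 1 / \<bar>\<xi>\<bar> * sqrt \<bar>\<xi>\<bar> * cmod (\<integral>x. F k x * cnj (fourier_char (- l) x) \<partial>lborel)"
      by (simp add: norm_mult)
    moreover have "r * a\<^sup>2 = b\<^sup>2" if "a = 1 / r * sqrt r * b" "r > 0" for a b r :: real
      using that by (simp add: power_mult_distrib power_divide) (simp add: power2_eq_square)
    ultimately show ?thesis using xi by simp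
  qed
  have F2: "(\<integral>\<^sup>+x. ennreal ((cmod (F k x))\<^sup>2) \<partial>lborel)
     = \<bar>\<xi>\<bar> * (\<integral>\<^sup>+t. ennreal ((cmod (v t))\<^sup>2) * indicator {t. signed_window (\<xi>, t - of_int k) = 1} t \<partial>lborel)" for k
  proof -
    have "(\<integral>\<^sup>+t. ennreal ((cmod (v t))\<^sup>2) * indicator {t. signed_window (\<xi>, t - of_int k) = 1} t \<partial>lborel)
       = ennreal \<bar>1 / \<xi>\<bar> * (\<integral>\<^sup>+x. ennreal ((cmod (v (of_int k + 1 / \<xi> * x)))\<^sup>2) *
          indicator {t. signed_window (\<xi>, t - of_int k) = 1} (of_int k + 1 / \<xi> * x) \<partial>lborel)"
      by (rule nn_integral_real_affine) (use xi in auto)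
    also have "\<dots> = ennreal \<bar>1 / \<xi>\<bar> * (\<integral>\<^sup>+x. ennreal ((cmod (F k x))\<^sup>2) \<partial>lborel)"
      using box[of k] by (intro arg_cong2[of _ _ _ _ "(*)"] nn_integral_cong refl)
        (auto simp: F_def indicator_def split: if_splits)
    finally show ?thesis using xi
      by (simp add: mult.assoc[symmetric] ennreal_mult[symmetric])
  qed
  show "((\<lambda>j. (cmod (L2_inner lebesgue u (?\<psi> j)))\<^sup>2) has_sum (L2_norm lebesgue u)\<^sup>2) UNIV"
  proof (subst has_sum_iff_nn_integral)
    let ?S = "\<lambda>k. {t. signed_window (\<xi>, t - of_int k) = 1}"
    have S [measurable]: "?S k \<in> sets borel" for k :: int
    proof -
      have "{t \<in> space borel. signed_window (\<xi>, t - of_int k) = 1} \<in> sets borel" by measurable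
      thus ?thesis by simp
    qed
    have inner: "(\<integral>\<^sup>+l. ennreal ((cmod (L2_inner lebesgue u (?\<psi> (k, l))))\<^sup>2) \<partial>count_space UNIV)
      = (\<integral>\<^sup>+t. ennreal ((cmod (v t))\<^sup>2) * indicator (?S k) t \<partial>lborel)" for k
    proof -
      have sqF: "square_integrable lborel (F k)"
      proof -
        have "integrable lborel (\<lambda>x. (cmod (v (of_int k + 1 / \<xi> * x)))\<^sup>2)"
          by (rule lborel_integrable_real_affine[OF v2]) (use xi in simp)
        hence "integrable lborel (\<lambda>x. (cmod (F k x))\<^sup>2)"
        proof (rule Bochner_Integration.integrable_bound)
          show "AE x in lborel. norm ((cmod (F k x))\<^sup>2) \<le> norm ((cmod (v (of_int k + 1 / \<xi> * x)))\<^sup>2)"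
            by (rule AE_I2) (auto simp: F_def indicator_def)
        qed measurable
        thus ?thesis by (simp add: square_integrable_def)
      qed
      have parseval: "(\<integral>\<^sup>+m. ennreal ((cmod (\<integral>x. F k x * cnj (fourier_char m x) \<partial>lborel))\<^sup>2) \<partial>count_space UNIV)
          = (\<integral>\<^sup>+x. ennreal ((cmod (F k x))\<^sup>2) \<partial>lborel)"
        by (rule fourier_parseval_disjoint_translates[OF sqF])
          (use xi in \<open>auto intro!: AE_I2 simp: F_def indicator_def\<close>)
      have "(\<integral>\<^sup>+l. ennreal ((cmod (L2_inner lebesgue u (?\<psi> (k, l))))\<^sup>2) \<partial>count_space UNIV)
        = (\<integral>\<^sup>+l. ennreal (1 / \<bar>\<xi>\<bar>) * ennreal ((cmod (\<integral>x. F k x * cnj (fourier_char (- l) x) \<partial>lborel))\<^sup>2) \<partial>count_space UNIV)"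
        by (intro nn_integral_cong) (simp add: coeff[symmetric] ennreal_mult[symmetric] xi)
      also have "\<dots> = ennreal (1 / \<bar>\<xi>\<bar>) * (\<integral>\<^sup>+l. ennreal ((cmod (\<integral>x. F k x * cnj (fourier_char (- l) x) \<partial>lborel))\<^sup>2) \<partial>count_space UNIV)"
        by (simp add: nn_integral_cmult)
      also have "(\<integral>\<^sup>+l. ennreal ((cmod (\<integral>x. F k x * cnj (fourier_char (- l) x) \<partial>lborel))\<^sup>2) \<partial>count_space UNIV)
        = (\<integral>\<^sup>+m. ennreal ((cmod (\<integral>x. F k x * cnj (fourier_char m x) \<partial>lborel))\<^sup>2) \<partial>count_space UNIV)"
        by (rule nn_integral_bij_count_space) (auto intro!: bij_betwI[of _ _ _ uminus])
      also have "ennreal (1 / \<bar>\<xi>\<bar>) * \<dots> = (\<integral>\<^sup>+t. ennreal ((cmod (v t))\<^sup>2) * indicator (?S k) t \<partial>lborel)"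
        unfolding parseval F2 using xi by (simp add: mult.assoc[symmetric] ennreal_mult[symmetric])
      finally show ?thesis .
    qed
    have tile: "(\<integral>\<^sup>+k. ennreal ((cmod (v t))\<^sup>2) * indicator (?S k) t \<partial>count_space UNIV) = ennreal ((cmod (v t))\<^sup>2)" for t
    proof -
      obtain n where n: "\<And>k. signed_window (\<xi>, t - of_int k) = of_bool (k = n)"
        using signed_window_tiles[OF xi(1)] by blast
      have "(\<integral>\<^sup>+k. ennreal ((cmod (v t))\<^sup>2) * indicator (?S k) t \<partial>count_space UNIV)
        = (\<integral>\<^sup>+k. ennreal ((cmod (v t))\<^sup>2) * indicator {n} k \<partial>count_space UNIV)"
        by (intro nn_integral_cong) (auto simp: n indicator_def)
      thus ?thesis by (simp add: nn_integral_cmult_indicator)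
    qed
    have "(\<integral>\<^sup>+j. ennreal ((cmod (L2_inner lebesgue u (?\<psi> j)))\<^sup>2) \<partial>count_space UNIV)
      = (\<integral>\<^sup>+k. \<integral>\<^sup>+l. ennreal ((cmod (L2_inner lebesgue u (?\<psi> (k, l))))\<^sup>2) \<partial>count_space UNIV \<partial>count_space UNIV)"
      by (rule nn_integral_fst_count_space[symmetric])
    also have "\<dots> = (\<integral>\<^sup>+k. \<integral>\<^sup>+t. ennreal ((cmod (v t))\<^sup>2) * indicator (?S k) t \<partial>lborel \<partial>count_space UNIV)"
      unfolding inner ..
    also have "\<dots> = (\<integral>\<^sup>+t. \<integral>\<^sup>+k. ennreal ((cmod (v t))\<^sup>2) * indicator (?S k) t \<partial>count_space UNIV \<partial>lborel)"
      by (rule nn_integral_count_space_nn_integral[symmetric]) auto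
    also have "\<dots> = ennreal ((L2_norm lebesgue u)\<^sup>2)"
      unfolding tile norm_u by (rule nn_integral_eq_integral[OF v2]) simp
    finally show "(\<integral>\<^sup>+j. ennreal ((cmod (L2_inner lebesgue u (?\<psi> j)))\<^sup>2) \<partial>count_space UNIV)
      = ennreal ((L2_norm lebesgue u)\<^sup>2)" .
  qed auto
qed

text \<open>Square integrability holds as the support of the field lies in a bounded box over \<open>[-1,1]\<close>.\<close>

lemma gabor_field_signed_window:
  assumes I: "I \<in> sets lebesgue" and sub: "I \<subseteq> {-1..1}"
  shows "gabor_field I signed_window"
  unfolding gabor_field_def
proof
  have IU: "indicator (I \<times> (UNIV :: real set)) \<in> borel_measurable (lebesgue :: (real \<times> real) measure)"
    by (rule borel_measurable_indicator[OF sets_lebesgue_Times_UNIV[OF I]])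
  have m: "signed_window \<in> borel_measurable (field_measure I)"
    unfolding field_measurable_iff[OF I]
    by (rule borel_measurable_scaleR[OF IU borel_measurable_lebesgueI[OF signed_window_borel]])
  have "integrable lebesgue (\<lambda>z. (cmod (weighted I signed_window z))\<^sup>2)"
  proof (rule Bochner_Integration.integrable_bound)
    have "integrable lborel (indicator (cbox (-1, -1) (1, 1)) :: real \<times> real \<Rightarrow> real)"
      using emeasure_lborel_cbox_finite by (intro integrable_real_indicator) auto
    thus "integrable lebesgue (indicator (cbox (-1, -1) (1, 1)) :: real \<times> real \<Rightarrow> real)"
      by (subst integrable_completion) auto
    show "(\<lambda>z. (cmod (weighted I signed_window z))\<^sup>2) \<in> borel_measurable lebesgue"
      using weighted_measurable[OF I m] by measurable
    show "AE z in lebesgue. norm ((cmod (weighted I signed_window z))\<^sup>2) \<le> norm (indicator (cbox (-1, -1) (1, 1)) z :: real)"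
    proof (rule AE_I2)
      fix z :: "real \<times> real"
      obtain \<xi> t where z: "z = (\<xi>, t)" by (cases z)
      have "\<bar>t\<bar> < 1" if "\<xi> * t < \<bar>\<xi>\<bar>" "0 \<le> \<xi> * t"
      proof -
        have "\<bar>\<xi>\<bar> * \<bar>t\<bar> < \<bar>\<xi>\<bar> * 1" using that by (simp add: abs_mult[symmetric])
        thus ?thesis using mult_less_cancel_left[of "\<bar>\<xi>\<bar>" "\<bar>t\<bar>" 1] by auto
      qed
      thus "norm ((cmod (weighted I signed_window z))\<^sup>2) \<le> norm (indicator (cbox (-1, -1) (1, 1)) z :: real)"
        using sub by (fastforce simp: z norm_weighted_square signed_window_def indicator_def cbox_Pair_eq abs_less_iff)
    qed
  qed
  with m show "square_integrable (field_measure I) signed_window" by (simp add: square_integrable_field_iff[OF I])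
  have "AE \<xi> in lebesgue_on I. \<xi> \<noteq> 0 \<and> \<bar>\<xi>\<bar> \<le> 1"
  proof (subst AE_restrict_space_iff)
    show "AE \<xi> in lebesgue. \<xi> \<in> I \<longrightarrow> \<xi> \<noteq> 0 \<and> \<bar>\<xi>\<bar> \<le> 1"
      using AE_completion[OF AE_lborel_singleton[of "0::real"]] by eventually_elim (use sub in force)
  qed (use I in auto)
  thus "AE \<xi> in lebesgue_on I. parseval_frame_L2 lebesgue UNIV
          (\<lambda>(k :: int, l :: int) t.
             complex_of_real (sqrt \<bar>\<xi>\<bar>) * cis (- (2 * pi * \<xi> * of_int l * t)) *
             signed_window (\<xi>, t - of_int k))"
    by eventually_elim (rule signed_window_parseval, auto)
qed

text \<open>For \<open>\<xi>\<close> in \<open>[-1,0]\<close> the windows over \<open>\<xi>\<close> and \<open>\<xi> + 1\<close> are \<open>[0, |\<xi>|)\<close> and \<open>[0, 1 - |\<xi>|)\<close> in the variable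
  \<open>x = \<xi> t\<close>, and this is the length of their intersection. Both points have the same overlap.\<close>

definition overlap :: "real \<Rightarrow> real" where
  "overlap \<xi> = min \<bar>\<xi>\<bar> (1 - \<bar>\<xi>\<bar>)"

definition arc_coeff :: "int \<Rightarrow> real \<Rightarrow> complex" where
  "arc_coeff l m = (\<integral>x. indicator {0..<m} x * fourier_char l x \<partial>lborel)"

lemma arc_coeff_measurable [measurable]: "arc_coeff l \<in> borel_measurable borel"
proof -
  have "{z \<in> space borel. 0 \<le> snd z \<and> snd z < fst z} \<in> sets (borel :: (real \<times> real) measure)"
    by measurable
  hence S: "{z. 0 \<le> snd z \<and> snd z < fst z} \<in> sets (borel :: (real \<times> real) measure)" by simp
  have "(\<lambda>z. indicator {z. 0 \<le> snd z \<and> snd z < fst z} z * fourier_char l (snd z)) \<in> borel_measurable borel"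
    using S by measurable
  moreover have "(\<lambda>z. indicator {z. 0 \<le> snd z \<and> snd z < fst z} z * fourier_char l (snd z))
      = (\<lambda>(m, x). indicator {0..<m} x * fourier_char l x)"
    by (auto simp: fun_eq_iff indicator_def)
  ultimately have "(\<lambda>(m, x). indicator {0..<m} x * fourier_char l x) \<in> borel_measurable (borel \<Otimes>\<^sub>M lborel)"
    by (subst measurable_cong_sets[of _ "borel :: (real \<times> real) measure"])
      (auto simp: borel_prod[symmetric] intro!: sets_pair_measure_cong)
  thus ?thesis unfolding arc_coeff_def[abs_def]
    by (rule lborel.borel_measurable_lebesgue_integral)
qed

lemma norm_arc_coeff_le: "0 \<le> m \<Longrightarrow> cmod (arc_coeff l m) \<le> m"
proof -
  assume m: "0 \<le> m"
  have "cmod (arc_coeff l m) \<le> (\<integral>x. cmod (indicator {0..<m} x * fourier_char l x) \<partial>lborel)"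
    unfolding arc_coeff_def by (rule integral_norm_bound)
  also have "\<dots> = (\<integral>x. indicator {0..<m} x \<partial>lborel)"
    by (intro Bochner_Integration.integral_cong refl) (auto simp: norm_mult indicator_def)
  also have "\<dots> = m" using m by simp
  finally show ?thesis .
qed

text \<open>The substitution \<open>x = \<xi> t\<close> removes \<open>\<xi>\<close> from the integral, which therefore depends on \<open>\<xi>\<close> only through
  \<open>m\<close>. For \<open>k \<noteq> 0\<close> the strip lies in the window and is disjoint from its translate by \<open>k\<close>.\<close>

lemma signed_window_strip_coeff:
  assumes xi: "\<xi> \<noteq> 0" and m: "m \<le> \<bar>\<xi>\<bar>"
  shows "\<bar>\<xi>\<bar> *\<^sub>R (\<integral>t. of_bool (0 \<le> \<xi> * t \<and> \<xi> * t < m) *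
      cnj (cis (- (2 * pi * \<xi> * of_int l * t)) * signed_window (\<xi>, t - of_int k)) \<partial>lborel)
    = of_bool (k = 0) * arc_coeff l m"
proof (cases "k = 0")
  case True
  let ?h = "\<lambda>t. of_bool (0 \<le> \<xi> * t \<and> \<xi> * t < m) *
      cnj (cis (- (2 * pi * \<xi> * of_int l * t)) * signed_window (\<xi>, t - of_int k))"
  have "\<bar>\<xi>\<bar> *\<^sub>R integral\<^sup>L lborel ?h = \<bar>\<xi>\<bar> *\<^sub>R (\<bar>1 / \<xi>\<bar> *\<^sub>R (\<integral>x. ?h (0 + 1 / \<xi> * x) \<partial>lborel))"
    using xi by (subst lborel_integral_real_affine[of "1 / \<xi>" ?h 0]) auto
  also have "\<dots> = (\<integral>x. ?h (0 + 1 / \<xi> * x) \<partial>lborel)" using xi by simp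
  also have "\<dots> = arc_coeff l m" unfolding arc_coeff_def
  proof (intro Bochner_Integration.integral_cong refl)
    fix x
    have "2 * pi * \<xi> * of_int l * (0 + 1 / \<xi> * x) = 2 * pi * x * of_int l" using xi by simp
    thus "?h (0 + 1 / \<xi> * x) = indicator {0..<m} x * fourier_char l x"
      using xi m True by (auto simp: signed_window_def indicator_def fourier_char_def cis_cnj mult_ac)
  qed
  finally show ?thesis using True by simp
next
  case False
  have vanish: "of_bool (0 \<le> \<xi> * t \<and> \<xi> * t < m) * cnj (c * signed_window (\<xi>, t - of_int k)) = 0" for t c
  proof (cases "0 \<le> \<xi> * t \<and> \<xi> * t < m")
    case strip: True
    obtain n where n: "\<And>k. signed_window (\<xi>, t - of_int k) = of_bool (k = n)"
      using signed_window_tiles[OF xi] by blast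
    have "signed_window (\<xi>, t - of_int 0) = 1" using strip m by (simp add: signed_window_def)
    hence "n = 0" using n[of 0] by (auto split: if_splits)
    thus ?thesis using n[of k] False by simp
  qed simp
  show ?thesis unfolding vanish using False by simp
qed

text \<open>Over a pair \<open>\<xi>\<close>, \<open>\<xi> + 1\<close> of points of \<open>I\<close> the field of signed windows produces coinciding coefficients
  for the indicator functions of the common part of the two windows. Their difference is orthogonal to the
  whole system, so it must vanish if the system is a Parseval frame.\<close>

theorem GH_frame_set_imp_disjoint_translates:
  assumes I: "I \<in> sets lebesgue" and sub: "I \<subseteq> {-1..1}" and GH: "GH_frame_set I"
  shows "{x \<in> I. x + 1 \<in> I} \<in> null_sets lebesgue"
proof -
  let ?A = "{x \<in> I. x + 1 \<in> I}"
  have "(\<lambda>z. z - (-1)) -` I \<inter> space lebesgue \<in> sets lebesgue"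
    by (rule measurable_sets[OF lebesgue_shift_measurable I])
  moreover have "?A = I \<inter> ((\<lambda>z. z - (-1)) -` I \<inter> space lebesgue)" by auto
  ultimately have "?A \<in> sets lebesgue" using I by (simp only: sets.Int)
  then obtain C T where C [measurable]: "C \<in> sets borel" and T: "T \<in> null_sets lebesgue" and CT: "C \<union> T = ?A"
    using lebesgue_borel_core by blast
  have C_dom: "\<xi> \<in> I" "\<xi> + 1 \<in> I" "-1 \<le> \<xi>" "\<xi> \<le> 0" if "\<xi> \<in> C" for \<xi>
    using that CT sub by force+
  \<comment> \<open>The sign is \<open>-1\<close> on \<open>C\<close> and \<open>+1\<close> on \<open>C + 1\<close>; these sets can meet only in \<open>0\<close>, where the strip below is empty.\<close>
  define s :: "real \<Rightarrow> real" where "s \<xi> = indicator C (\<xi> - 1) - indicator C \<xi>" for \<xi>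
  define f :: "real \<times> real \<Rightarrow> complex" where
    "f = (\<lambda>(\<xi>, t). of_real (s \<xi>) * of_bool (0 \<le> \<xi> * t \<and> \<xi> * t < overlap \<xi>))"
  define f' where "f' z = sqrt \<bar>fst z\<bar> *\<^sub>R f z" for z
  have s_off: "s \<xi> = 0" if "\<xi> \<notin> I" for \<xi>
    using that C_dom[of \<xi>] C_dom[of "\<xi> - 1"] by (auto simp: s_def indicator_def)
  have s_le: "\<bar>s \<xi>\<bar> \<le> 1" for \<xi> by (auto simp: s_def indicator_def)
  have wf: "weighted I f = f'"
    using s_off by (auto simp: fun_eq_iff weighted_def f_def f'_def indicator_def)
  have fb [measurable]: "f \<in> borel_measurable borel"
  proof -
    have "{z \<in> space borel. 0 \<le> fst z * snd z \<and> fst z * snd z < overlap (fst z)} \<in> sets (borel :: (real \<times> real) measure)"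
      unfolding overlap_def by measurable
    hence S: "{z. 0 \<le> fst z * snd z \<and> fst z * snd z < overlap (fst z)} \<in> sets (borel :: (real \<times> real) measure)"
      by simp
    have eq: "f = (\<lambda>z. of_real (s (fst z)) * indicator {z. 0 \<le> fst z * snd z \<and> fst z * snd z < overlap (fst z)} z)"
      by (auto simp: f_def fun_eq_iff indicator_def)
    have "s \<in> borel_measurable borel" unfolding s_def[abs_def] by measurable
    thus ?thesis unfolding eq using S by measurable
  qed
  have f'b [measurable]: "f' \<in> borel_measurable borel" unfolding f'_def[abs_def] by measurable
  have IU: "indicator (I \<times> (UNIV :: real set)) \<in> borel_measurable (lebesgue :: (real \<times> real) measure)"
    by (rule borel_measurable_indicator[OF sets_lebesgue_Times_UNIV[OF I]])
  have fm: "f \<in> borel_measurable (field_measure I)"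
    unfolding field_measurable_iff[OF I]
    by (rule borel_measurable_scaleR[OF IU borel_measurable_lebesgueI[OF fb]])
  have gab: "gabor_field I signed_window" by (rule gabor_field_signed_window[OF I sub])
  hence g: "square_integrable (field_measure I) signed_window" by (simp add: gabor_field_def)
  have gm: "signed_window \<in> borel_measurable (field_measure I)" using g by (simp add: square_integrable_def)
  have f: "square_integrable (field_measure I) f"
    unfolding square_integrable_def
  proof
    show "integrable (field_measure I) (\<lambda>z. (cmod (f z))\<^sup>2)"
    proof (rule Bochner_Integration.integrable_bound)
      show "integrable (field_measure I) (\<lambda>z. (cmod (signed_window z))\<^sup>2)"
        using g by (simp add: square_integrable_def)
      have "(cmod (f z))\<^sup>2 \<le> (cmod (signed_window z))\<^sup>2" for z
        using s_le[of "fst z"] by (cases z)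
          (auto simp: f_def signed_window_def overlap_def norm_mult abs_square_le_1)
      thus "AE z in field_measure I. norm ((cmod (f z))\<^sup>2) \<le> norm ((cmod (signed_window z))\<^sup>2)" by simp
    qed (use fm in measurable)
  qed (rule fm)
  obtain g' where g' [measurable]: "g' \<in> borel_measurable borel"
    and gg': "AE z in lborel. weighted I signed_window z = g' z"
    using lebesgue_borel_version[OF weighted_measurable[OF I gm]] by blast
  have coeff: "AE \<xi> in lborel. fiber_coeff f' g' k l \<xi> = of_real (s \<xi>) * (of_bool (k = 0) * arc_coeff l (overlap \<xi>))" for k l
    using AE_lborel_pair[OF gg'] AE_lborel_singleton[of 0]
  proof eventually_elim
    case (elim \<xi>)
    let ?E = "\<lambda>t. cis (- (2 * pi * \<xi> * of_int l * t))"
    let ?h = "\<lambda>t. of_bool (0 \<le> \<xi> * t \<and> \<xi> * t < overlap \<xi>) * cnj (?E t * signed_window (\<xi>, t - of_int k))"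
    have "fiber_coeff f' g' k l \<xi> = (\<integral>t. (\<bar>\<xi>\<bar> * s \<xi>) *\<^sub>R ?h t \<partial>lborel)"
      unfolding fiber_coeff_def
    proof (rule integral_cong_AE)
      have "{t \<in> space borel. 0 \<le> \<xi> * t \<and> \<xi> * t < overlap \<xi>} \<in> sets borel" by measurable
      hence S: "{t. 0 \<le> \<xi> * t \<and> \<xi> * t < overlap \<xi>} \<in> sets borel" by simp
      have "(\<lambda>t. of_bool (0 \<le> \<xi> * t \<and> \<xi> * t < overlap \<xi>) :: complex) = indicator {t. 0 \<le> \<xi> * t \<and> \<xi> * t < overlap \<xi>}"
        by (auto simp: fun_eq_iff indicator_def)
      hence [measurable]: "(\<lambda>t. of_bool (0 \<le> \<xi> * t \<and> \<xi> * t < overlap \<xi>) :: complex) \<in> borel_measurable borel"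
        using S by (simp only: borel_measurable_indicator)
      show "(\<lambda>t. (\<bar>\<xi>\<bar> * s \<xi>) *\<^sub>R ?h t) \<in> borel_measurable lborel" by measurable
      show "AE t in lborel. f' (\<xi>, t) * cnj (?E t * g' (\<xi>, t - of_int k)) = (\<bar>\<xi>\<bar> * s \<xi>) *\<^sub>R ?h t"
        using lborel_AE_shift[OF elim(1), of "of_int k"]
      proof eventually_elim
        case (elim t)
        show ?case
        proof (cases "\<xi> \<in> I")
          case True
          have "sqrt \<bar>\<xi>\<bar> * sqrt \<bar>\<xi>\<bar> = \<bar>\<xi>\<bar>" by simp
          hence q: "complex_of_real (sqrt \<bar>\<xi>\<bar>) * of_real (sqrt \<bar>\<xi>\<bar>) = of_real \<bar>\<xi>\<bar>"
            by (simp only: of_real_mult[symmetric])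
          have "g' (\<xi>, t - of_int k) = of_real (sqrt \<bar>\<xi>\<bar>) * signed_window (\<xi>, t - of_int k)"
            using elim True by (simp add: weighted_def scaleR_conv_of_real)
          hence "f' (\<xi>, t) * cnj (?E t * g' (\<xi>, t - of_int k))
            = (complex_of_real (sqrt \<bar>\<xi>\<bar>) * of_real (sqrt \<bar>\<xi>\<bar>)) * (of_real (s \<xi>) * ?h t)"
            by (simp add: f'_def f_def scaleR_conv_of_real mult_ac)
          thus ?thesis unfolding q by (simp add: scaleR_conv_of_real mult_ac)
        next
          case False
          thus ?thesis using s_off by (simp add: f'_def f_def)
        qed
      qed
    qed measurable
    also have "\<dots> = s \<xi> *\<^sub>R (\<bar>\<xi>\<bar> *\<^sub>R integral\<^sup>L lborel ?h)" by simp
    also have "\<bar>\<xi>\<bar> *\<^sub>R integral\<^sup>L lborel ?h = of_bool (k = 0) * arc_coeff l (overlap \<xi>)"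
      by (rule signed_window_strip_coeff) (use elim in \<open>auto simp: overlap_def\<close>)
    finally show ?case by (simp add: scaleR_conv_of_real)
  qed
  have orth: "L2_inner (field_measure I) f (T_hat k l m signed_window) = 0" for k l m
  proof -
    \<comment> \<open>Since \<open>C\<close> and \<open>C + 1\<close> carry opposite signs, the integrand is a translate of \<open>Q\<close> minus \<open>Q\<close>.\<close>
    define Q where "Q \<xi> = indicator C \<xi> * (of_bool (k = 0) * arc_coeff l (overlap \<xi>) * cnj (fourier_char m \<xi>))" for \<xi>
    have [measurable]: "overlap \<in> borel_measurable borel" unfolding overlap_def[abs_def] by measurable
    have Qm [measurable]: "Q \<in> borel_measurable borel" unfolding Q_def[abs_def] by measurable
    have Q: "integrable lborel Q"
    proof (rule Bochner_Integration.integrable_bound)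
      show "integrable lborel (indicator {-1..0} :: real \<Rightarrow> real)" by (rule integrable_real_indicator) auto
      show "AE \<xi> in lborel. norm (Q \<xi>) \<le> norm (indicator {-1..0} \<xi> :: real)"
      proof (rule AE_I2)
        fix \<xi>
        have "cmod (arc_coeff l (overlap \<xi>)) \<le> 1" if "\<xi> \<in> C"
          using norm_arc_coeff_le[of "overlap \<xi>" l] C_dom[OF that] by (auto simp: overlap_def)
        thus "norm (Q \<xi>) \<le> norm (indicator {-1..0} \<xi> :: real)"
          using C_dom[of \<xi>] by (auto simp: Q_def norm_mult indicator_def)
      qed
    qed measurable
    have eq: "of_real (s \<xi>) * (of_bool (k = 0) * arc_coeff l (overlap \<xi>)) * cnj (fourier_char m \<xi>) = Q (\<xi> - 1) - Q \<xi>" for \<xi>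
    proof -
      have "overlap (\<xi> - 1) = overlap \<xi>" if "\<xi> - 1 \<in> C"
        using C_dom[OF that] by (auto simp: overlap_def)
      moreover have "fourier_char m (\<xi> - 1) = fourier_char m \<xi>"
        using fourier_char_add_arg[of m "\<xi> - 1" 1] fourier_char_of_int[of m 1] by simp
      ultimately show ?thesis by (auto simp: s_def Q_def indicator_def)
    qed
    have "L2_inner (field_measure I) f (T_hat k l m signed_window)
      = (\<integral>\<xi>. fiber_coeff f' g' k l \<xi> * cnj (fourier_char m \<xi>) \<partial>lborel)"
      by (rule L2_inner_T_hat[OF I f g f'b _ g' gg']) (simp add: wf)
    also have "\<dots> = (\<integral>\<xi>. Q (\<xi> - 1) - Q \<xi> \<partial>lborel)"
    proof (rule integral_cong_AE)
      show "AE \<xi> in lborel. fiber_coeff f' g' k l \<xi> * cnj (fourier_char m \<xi>) = Q (\<xi> - 1) - Q \<xi>"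
        using coeff[of k l] by eventually_elim (simp only: eq)
    qed measurable
    also have "\<dots> = (\<integral>\<xi>. Q (\<xi> - 1) \<partial>lborel) - (\<integral>\<xi>. Q \<xi> \<partial>lborel)"
      using Q lborel_integrable_shift[OF Q, of 1] by (rule Bochner_Integration.integral_diff[rotated])
    also have "(\<integral>\<xi>. Q (\<xi> - 1) \<partial>lborel) = (\<integral>\<xi>. Q \<xi> \<partial>lborel)"
      using lborel_integral_real_affine[of 1 Q "-1"] by simp
    finally show ?thesis by simp
  qed
  have "parseval_frame_L2 (field_measure I) UNIV (\<lambda>(k, l, m). T_hat k l m signed_window)"
    using GH gab unfolding GH_frame_set_def by blast
  from conjunct2[OF this[unfolded parseval_frame_L2_def], rule_format, OF f]
  have sum: "((\<lambda>j. (cmod (L2_inner (field_measure I) f (case j of (k, l, m) \<Rightarrow> T_hat k l m signed_window)))\<^sup>2)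
      has_sum (L2_norm (field_measure I) f)\<^sup>2) UNIV" .
  have "(L2_norm (field_measure I) f)\<^sup>2 = 0"
    by (rule has_sum_unique[OF sum has_sum_0]) (auto simp: orth)
  hence "(\<integral>z. (cmod (f' z))\<^sup>2 \<partial>lebesgue) = 0" by (simp add: L2_norm_field[OF I fm] wf)
  moreover have "integrable lebesgue (\<lambda>z. (cmod (f' z))\<^sup>2)"
    using f by (simp add: square_integrable_field_iff[OF I] wf)
  ultimately have "AE z in lebesgue. (cmod (f' z))\<^sup>2 = 0"
    by (subst (asm) integral_nonneg_eq_0_iff_AE) auto
  hence "AE z in lborel. (cmod (f' z))\<^sup>2 = 0" by (simp only: AE_completion_iff)
  hence "AE \<xi> in lborel. AE t in lborel. (cmod (f' (\<xi>, t)))\<^sup>2 = 0" by (rule AE_lborel_pair)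
  hence "AE \<xi> in lborel. \<xi> \<notin> C"
    using AE_lborel_singleton[of 0] AE_lborel_singleton[of "-1"]
  proof eventually_elim
    case (elim \<xi>)
    show ?case
    proof
      assume xi: "\<xi> \<in> C"
      hence r: "-1 < \<xi>" "\<xi> < 0" using C_dom[OF xi] elim by auto
      have s: "s \<xi> = -1" using xi C_dom[of "\<xi> - 1"] r by (auto simp: s_def indicator_def)
      have ov: "overlap \<xi> > 0" using r by (auto simp: overlap_def)
      have "AE t in lborel. t \<notin> {overlap \<xi> / \<xi><..0}"
        using elim(1)
      proof eventually_elim
        case (elim t)
        show ?case
        proof
          assume t: "t \<in> {overlap \<xi> / \<xi><..0}"
          hence "0 \<le> \<xi> * t" using r by (simp add: mult_nonpos_nonpos)
          moreover have "\<xi> * t < overlap \<xi>" using t r by (simp add: neg_divide_less_eq mult.commute)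
          ultimately show False using elim r s by (simp add: f'_def f_def)
        qed
      qed
      hence "{overlap \<xi> / \<xi><..0} \<in> null_sets lborel" by (subst AE_iff_null_sets) auto
      moreover have "overlap \<xi> / \<xi> < 0" using ov r by (simp add: divide_pos_neg)
      ultimately show False by (auto simp: null_sets_def)
    qed
  qed
  hence "C \<in> null_sets lborel" by (subst AE_iff_null_sets) auto
  hence "C \<in> null_sets lebesgue" by (rule null_sets_completionI)
  hence "C \<union> T \<in> null_sets lebesgue" using T by (rule null_sets.Un)
  thus ?thesis by (simp only: CT)
qed

section \<open>Translation congruence\<close>

text \<open>After removing the points \<open>x\<close> with \<open>x + 1\<close> in \<open>I\<close>, adding \<open>1\<close> to the negative points is injective.\<close>

lemma disjoint_translates_imp_congruent:
  assumes I: "I \<in> sets lebesgue" and sub: "I \<subseteq> {-1..1}"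
    and null: "{x \<in> I. x + 1 \<in> I} \<in> null_sets lebesgue"
  shows "\<exists>J. J \<in> sets lebesgue \<and> J \<subseteq> {0..1} \<and> translation_congruent I J"
proof -
  define I' where "I' = I - {x \<in> I. x + 1 \<in> I}"
  define k :: "real \<Rightarrow> int" where "k x = (if x < 0 then 1 else 0)" for x
  define \<tau> where "\<tau> x = x + of_int (k x)" for x
  have I': "I' \<in> sets lebesgue" unfolding I'_def using I null by blast
  have eqI: "equal_mod_null I I'"
  proof -
    have "sym_diff I I' = {x \<in> I. x + 1 \<in> I}" by (auto simp: I'_def)
    thus ?thesis using null by (simp add: equal_mod_null_def)
  qed
  have inj: "inj_on \<tau> I'"
  proof (rule inj_onI)
    fix x y assume "x \<in> I'" "y \<in> I'" "\<tau> x = \<tau> y"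
    thus "x = y" by (auto simp: \<tau>_def k_def I'_def split: if_splits)
  qed
  have img: "\<tau> ` I' = (I' \<inter> {0..}) \<union> ((\<lambda>x. x - 1) -` (I' \<inter> {..<0}) \<inter> space lebesgue)"
  proof (intro equalityI subsetI)
    fix y assume "y \<in> \<tau> ` I'"
    thus "y \<in> (I' \<inter> {0..}) \<union> ((\<lambda>x. x - 1) -` (I' \<inter> {..<0}) \<inter> space lebesgue)"
      by (auto simp: \<tau>_def k_def split: if_splits)
  next
    fix y assume "y \<in> (I' \<inter> {0..}) \<union> ((\<lambda>x. x - 1) -` (I' \<inter> {..<0}) \<inter> space lebesgue)"
    then consider "y \<in> I'" "y \<ge> 0" | "y - 1 \<in> I'" "y - 1 < 0" by auto
    thus "y \<in> \<tau> ` I'"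
    proof cases
      case 1 thus ?thesis by (intro image_eqI[of _ _ y]) (auto simp: \<tau>_def k_def)
    next
      case 2 thus ?thesis by (intro image_eqI[of _ _ "y - 1"]) (auto simp: \<tau>_def k_def)
    qed
  qed
  have J: "\<tau> ` I' \<in> sets lebesgue"
    unfolding img
    by (intro sets.Un sets.Int I' measurable_sets[OF lebesgue_shift_measurable] sets_completionI_sets) auto
  have Jsub: "\<tau> ` I' \<subseteq> {0..1}"
    using sub by (auto simp: \<tau>_def k_def I'_def split: if_splits)
  have "k \<in> lborel \<rightarrow>\<^sub>M count_space UNIV" unfolding k_def[abs_def] by measurable
  hence km: "k \<in> lebesgue_on I' \<rightarrow>\<^sub>M count_space UNIV"
    by (intro measurable_restrict_space1 measurable_completion)
  have "translation_congruent_strict I' (\<tau> ` I')"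
    unfolding translation_congruent_strict_def
    by (rule exI[of _ \<tau>], rule exI[of _ k]) (use inj km in \<open>auto simp: bij_betw_def \<tau>_def\<close>)
  moreover have "equal_mod_null (\<tau> ` I') (\<tau> ` I')" by (simp add: equal_mod_null_def)
  ultimately have "translation_congruent I (\<tau> ` I')"
    unfolding translation_congruent_def using I' J eqI by blast
  with J Jsub show ?thesis by blast
qed

text \<open>Up to null sets, if \<open>x\<close> and \<open>x + 1\<close> belong to \<open>I\<close>, their images under the congruence are distinct points of \<open>[0,1]\<close> at an integer distance,
  hence end points, and \<open>x\<close> is an integer. The exceptional sets are covered by countably many integer
  translates of null sets.\<close>

lemma congruent_imp_disjoint_translates:
  assumes J: "J \<subseteq> {0..1}" and cong: "translation_congruent I J"
  shows "{x \<in> I. x + 1 \<in> I} \<in> null_sets lebesgue"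
proof -
  obtain I' J' \<tau> k where eqI: "equal_mod_null I I'" and eqJ: "equal_mod_null J J'"
    and bij: "bij_betw \<tau> I' J'" and \<tau>: "\<And>x. x \<in> I' \<Longrightarrow> \<tau> x = x + of_int (k x :: int)"
    using cong unfolding translation_congruent_def translation_congruent_strict_def by metis
  let ?NI = "sym_diff I I'" and ?NJ = "sym_diff J J'"
  let ?N = "?NI \<union> {x. x + 1 \<in> ?NI} \<union> (\<Union>n::int. {x. x + of_int n \<in> ?NJ}) \<union> range of_int"
  have NI: "?NI \<in> null_sets lebesgue" and NJ: "?NJ \<in> null_sets lebesgue"
    using eqI eqJ by (simp_all add: equal_mod_null_def)
  have "countable (range (of_int :: int \<Rightarrow> real))" by simp
  hence Z: "range (of_int :: int \<Rightarrow> real) \<in> null_sets lebesgue"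
    by (intro null_sets_completionI countable_imp_null_set_lborel)
  have "?N \<in> null_sets lebesgue"
    by (intro null_sets.Un null_sets_UN NI null_sets_shift[OF NI] null_sets_shift[OF NJ] Z)
  moreover have "{x \<in> I. x + 1 \<in> I} \<subseteq> ?N"
  proof
    fix x assume x: "x \<in> {x \<in> I. x + 1 \<in> I}"
    show "x \<in> ?N"
    proof (rule ccontr)
      assume not: "x \<notin> ?N"
      have I': "x \<in> I'" "x + 1 \<in> I'" using not x by auto
      have NJ: "x + of_int n \<notin> ?NJ" for n :: int using not by blast
      have eq: "\<tau> x = x + of_int (k x)" "\<tau> (x + 1) = x + of_int (1 + k (x + 1))"
        using \<tau> I' by auto
      have "\<tau> x \<in> J'" "\<tau> (x + 1) \<in> J'" using bij I' by (auto simp: bij_betw_def)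
      hence "x + of_int (k x) \<in> {0..1}" "x + of_int (1 + k (x + 1)) \<in> {0..1}"
        using NJ[of "k x"] NJ[of "1 + k (x + 1)"] J unfolding eq by blast+
      moreover have "\<tau> x \<noteq> \<tau> (x + 1)"
        using bij I' inj_onD[of \<tau> I' x "x + 1"] by (auto simp: bij_betw_def)
      hence "k x \<noteq> 1 + k (x + 1)" unfolding eq by auto
      ultimately have "x = of_int (- k x) \<or> x = of_int (- (1 + k (x + 1)))" by auto
      thus False using not by blast
    qed
  qed
  ultimately show ?thesis by (rule null_sets_mono_lebesgue)
qed

theorem proposition3p5:
  fixes I :: "real set"
  assumes "I \<in> sets lebesgue" and "I \<subseteq> {-1..1}"
  shows "GH_frame_set I \<longleftrightarrow>
    (\<exists>J. J \<in> sets lebesgue \<and> J \<subseteq> {0..1} \<and> translation_congruent I J)"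
proof
  assume "GH_frame_set I"
  thus "\<exists>J. J \<in> sets lebesgue \<and> J \<subseteq> {0..1} \<and> translation_congruent I J"
    by (intro disjoint_translates_imp_congruent GH_frame_set_imp_disjoint_translates assms)
next
  assume "\<exists>J. J \<in> sets lebesgue \<and> J \<subseteq> {0..1} \<and> translation_congruent I J"
  thus "GH_frame_set I"
    using disjoint_translates_imp_GH_frame_set[OF assms] congruent_imp_disjoint_translates by blast
qed

end
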